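(* Assume (A1)-(A3). Then the value function $V_T$ is the unique function $\varphi$ in $C_b([0,T]\times S)\cap C^1([0,T)\times S)$ satisfying $$\frac{d\varphi}{dt}(t,i)+\inf_{u\in U_i}\Bigl[\theta c(t,i,u)\varphi(t,i)+\sum_{j\in S}\lambda_{ij}(u)\varphi(t,j)\Bigr]=0\ \text{ on } [0,T)\times S,\qquad \varphi(T,i)=e^{\theta g(i)}\ \text{ for } i\in S.$$ Moreover, an optimal control for the criterion $\hat J_T$ exists and is given by the Markov control $U^*_t=\mathbf{u}^*(t,X_{t-})$, where $\mathbf{u}^*$ satisfies, for all $(t,i)\in[0,T)\times S$, $$\inf_{u\in U_i}\Bigl[\theta c(t,i,u)V_T(t,i)+\sum_{j}\lambda_{ij}(u)V_T(t,j)\Bigr]=\theta c(t,i,\mathbf{u}^*(t,i))V_T(t,i)+\sum_{j}\lambda_{ij}(\mathbf{u}^*(t,i))V_T(t,j).$$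
   Context: State space $S=\{0,1,2,\dots\}$ (countable, discrete). For each $i\in S$, $U_i$ is a (nonempty) compact metric space of actions; $U=\bigcup_i U_i$, $K=\{(i,u): i\in S,u\in U_i\}$. For $j\ne i$, $\lambda_{ij}:U_i\to[0,\infty)$ are given transition rates, and $\lambda_{ii}(u)=-\sum_{j\ne i}\lambda_{ij}(u)$. Assumptions: (A1) every $\lambda_{ij}$ is continuous; (A2) $\sup_i\sup_{u\in U_i}\{-\lambda_{ii}(u)\}\le M<\infty$; (A3) for each $i$ the series $\sum_{j\neq i}\lambda_{ij}(u)$ converges uniformly in $u\in U_i$ (so $\lambda_{ii}$ is continuous). A Markov control is a map $\mathbf{u}:[0,\infty)\times S\to U$ with $\mathbf{u}(\cdot,i)$ measurable and $U_i$-valued for each $i$; $\mathcal U$ is the set of Markov controls. Let $\Lambda^{\mathbf u}_tf(i)=\sum_j\lambda_{ij}(\mathbf u(t,i))f(j)$ for bounded $f:S\to\mathbb R$. Let $(X_t)_{t\ge0}$ be the canonical process on the space of right-continuous $S$-valued paths with left limits. $\mathbb P^{\mathbf u}_{s,i}$ (expectation $\mathbb E^{\mathbf u}_{s,i}$) is the law solving the well-posed martingale problem: $X_s=i$ a.s. and $f(X_t)-\int_s^t\Lambda^{\mathbf u}_rf(X_r)\,dr$, $t\ge s$, is a martingale for every bounded $f$; i.e. from time $s$ on, $X$ is a Markov jump process started at $i$ with rates $\lambda_{ij}(\mathbf u(t,i))$. The control process is $U_t=\mathbf u(t,X_{t-})$. Finite horizon data: $0<T<\infty$; $\theta\in(0,1)$;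 $c:[0,\infty)\times K\to[0,\infty)$ bounded with $(t,u)\mapsto c(t,i,u)$ continuous for each $i$; $g:S\to[0,\infty)$ bounded. For $(t,i)\in[0,T]\times S$, $$\hat J^{\mathbf u}_T(t,i)=\mathbb E^{\mathbf u}_{t,i}\Bigl[\exp\Bigl(\theta\Bigl[\int_t^Tc(s,X_s,U_s)\,ds+g(X_T)\Bigr]\Bigr)\Bigr],\qquad V_T(t,i)=\inf_{\mathbf u\in\mathcal U}\hat J^{\mathbf u}_T(t,i).$$ A Markov control $\mathbf u^*$ is optimal for $\hat J_T$ if $\hat J^{\mathbf u^*}_T(t,i)=V_T(t,i)$ for all $(t,i)\in[0,T]\times S$. $C_b([0,T]\times S)$ is the space of bounded continuous functions; $C^1([0,T)\times S)$ is the set of functions continuously differentiable in the first variable on $[0,T)$ for each $i$. *)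

theory Defs
  imports "HOL-Probability.Probability"
begin

text \<open>
  The state space is the discrete space \<^typ>\<open>nat\<close>. Rates are written \<open>lam i j v\<close>, including the
  diagonal \<open>lam i i v\<close>. A Markov control is a function \<open>u t i\<close> of time and state; only times
  \<open>t \<ge> 0\<close> matter.
\<close>

text \<open>
  Functions on \<open>[0,\<infinity>)\<close> are represented by total functions that are \<open>undefined\<close> at negative times.
\<close>

definition paths :: "(real \<Rightarrow> nat) set" where
  "paths = {\<omega> \<in> extensional {0..}.
     (\<forall>t\<ge>0. (\<omega> \<longlongrightarrow> \<omega> t) (at_right t)) \<and>
     (\<forall>t>0. \<exists>l. (\<omega> \<longlongrightarrow> l) (at_left t))}"

definition path_sigma :: "real set \<Rightarrow> (real \<Rightarrow> nat) measure" where
  "path_sigma R = sigma paths {{\<omega> \<in> paths. \<omega> r = j} | r j. r \<in> R}"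

definition martingale_from ::
    "'w measure \<Rightarrow> real \<Rightarrow> (real \<Rightarrow> 'w measure) \<Rightarrow> (real \<Rightarrow> 'w \<Rightarrow> real) \<Rightarrow> bool" where
  "martingale_from Q s F Y \<longleftrightarrow>
     (\<forall>t\<ge>s. subalgebra Q (F t) \<and> Y t \<in> borel_measurable (F t) \<and> integrable Q (Y t)) \<and>
     (\<forall>r t. s \<le> r \<and> r \<le> t \<longrightarrow> (AE \<omega> in Q. real_cond_exp Q (F r) (Y t) \<omega> = Y r \<omega>))"

definition generator ::
    "(nat \<Rightarrow> nat \<Rightarrow> 'u \<Rightarrow> real) \<Rightarrow> (real \<Rightarrow> nat \<Rightarrow> 'u) \<Rightarrow> real \<Rightarrow> (nat \<Rightarrow> real) \<Rightarrow> nat \<Rightarrow> real" where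
  "generator lam u t f i = (\<Sum>j. lam i j (u t i) * f j)"

text \<open>
  The filtration is the one generated by the process after the starting time \<open>s\<close>. Nothing is
  prescribed about the path before \<open>s\<close>, so a solution is determined only from time \<open>s\<close> on. A
  martingale for the larger filtration \<open>\<sigma>(X\<^sub>r : 0 \<le> r \<le> t)\<close> that is adapted to this one is also a
  martingale for this one.
\<close>

definition solves_martingale_problem ::
    "(nat \<Rightarrow> nat \<Rightarrow> 'u \<Rightarrow> real) \<Rightarrow> (real \<Rightarrow> nat \<Rightarrow> 'u) \<Rightarrow> real \<Rightarrow> nat \<Rightarrow> (real \<Rightarrow> nat) measure \<Rightarrow> bool"
  where
  "solves_martingale_problem lam u s i Q \<longleftrightarrow>
     prob_space Q \<and> sets Q = sets (path_sigma {0..}) \<and>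
     (AE \<omega> in Q. \<omega> s = i) \<and>
     (\<forall>f :: nat \<Rightarrow> real. bounded (range f) \<longrightarrow>
        martingale_from Q s (\<lambda>t. path_sigma {s..t})
          (\<lambda>t \<omega>. f (\<omega> t) - (LBINT r:{s..t}. generator lam u r f (\<omega> r))))"

definition markov_controls :: "(nat \<Rightarrow> 'u::metric_space set) \<Rightarrow> (real \<Rightarrow> nat \<Rightarrow> 'u) set" where
  "markov_controls U =
     {u. \<forall>i. (\<lambda>t. u t i) \<in> restrict_space borel {0..} \<rightarrow>\<^sub>M restrict_space borel (U i)}"

definition control_process :: "(real \<Rightarrow> nat \<Rightarrow> 'u) \<Rightarrow> real \<Rightarrow> (real \<Rightarrow> nat) \<Rightarrow> 'u" where
  "control_process u t \<omega> = u t (Lim (at_left t) \<omega>)"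

text \<open>
  At time \<open>0\<close> and at the jump times of the path the action \<open>control_process u s \<omega>\<close> need not lie in
  \<open>U (\<omega> s)\<close>. The value of \<open>c\<close> there is irrelevant, since on a bounded interval these are finitely
  many times. \<open>P u t i\<close> stands for the law of the controlled process started in \<open>i\<close> at time \<open>t\<close>.
\<close>

definition cost_J ::
    "((real \<Rightarrow> nat \<Rightarrow> 'u) \<Rightarrow> real \<Rightarrow> nat \<Rightarrow> (real \<Rightarrow> nat) measure) \<Rightarrow> real \<Rightarrow>
     (real \<Rightarrow> nat \<Rightarrow> 'u \<Rightarrow> real) \<Rightarrow> (nat \<Rightarrow> real) \<Rightarrow> real \<Rightarrow>
     (real \<Rightarrow> nat \<Rightarrow> 'u) \<Rightarrow> real \<Rightarrow> nat \<Rightarrow> real" where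
  "cost_J P \<theta> c g T u t i =
     (\<integral>\<omega>. exp (\<theta> * ((LBINT s:{t..T}. c s (\<omega> s) (control_process u s \<omega>)) + g (\<omega> T))) \<partial>P u t i)"

definition value_V ::
    "(nat \<Rightarrow> 'u::metric_space set) \<Rightarrow>
     ((real \<Rightarrow> nat \<Rightarrow> 'u) \<Rightarrow> real \<Rightarrow> nat \<Rightarrow> (real \<Rightarrow> nat) measure) \<Rightarrow> real \<Rightarrow>
     (real \<Rightarrow> nat \<Rightarrow> 'u \<Rightarrow> real) \<Rightarrow> (nat \<Rightarrow> real) \<Rightarrow> real \<Rightarrow> real \<Rightarrow> nat \<Rightarrow> real" where
  "value_V U P \<theta> c g T t i = (INF u\<in>markov_controls U. cost_J P \<theta> c g T u t i)"

definition optimal_control ::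
    "(nat \<Rightarrow> 'u::metric_space set) \<Rightarrow>
     ((real \<Rightarrow> nat \<Rightarrow> 'u) \<Rightarrow> real \<Rightarrow> nat \<Rightarrow> (real \<Rightarrow> nat) measure) \<Rightarrow> real \<Rightarrow>
     (real \<Rightarrow> nat \<Rightarrow> 'u \<Rightarrow> real) \<Rightarrow> (nat \<Rightarrow> real) \<Rightarrow> real \<Rightarrow> (real \<Rightarrow> nat \<Rightarrow> 'u) \<Rightarrow> bool" where
  "optimal_control U P \<theta> c g T u \<longleftrightarrow>
     u \<in> markov_controls U \<and>
     (\<forall>t\<in>{0..T}. \<forall>i. cost_J P \<theta> c g T u t i = value_V U P \<theta> c g T t i)"

definition Cb_space :: "real \<Rightarrow> (real \<Rightarrow> nat \<Rightarrow> real) set" where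
  "Cb_space T = {\<phi>. continuous_on ({0..T} \<times> UNIV) (\<lambda>(t, i). \<phi> t i) \<and>
                    bounded ((\<lambda>(t, i). \<phi> t i) ` ({0..T} \<times> UNIV))}"

text \<open>
  The derivative at \<open>0\<close> is one-sided; this is not what the library's \<open>C1_differentiable_on\<close>
  would express.
\<close>

definition C1_space :: "real \<Rightarrow> (real \<Rightarrow> nat \<Rightarrow> real) set" where
  "C1_space T = {\<phi>. \<forall>i. \<exists>D. continuous_on {0..<T} D \<and>
     (\<forall>t\<in>{0..<T}. ((\<lambda>s. \<phi> s i) has_vector_derivative D t) (at t within {0..<T}))}"

definition hamiltonian ::
    "(nat \<Rightarrow> nat \<Rightarrow> 'u \<Rightarrow> real) \<Rightarrow> real \<Rightarrow> (real \<Rightarrow> nat \<Rightarrow> 'u \<Rightarrow> real) \<Rightarrow>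
     (real \<Rightarrow> nat \<Rightarrow> real) \<Rightarrow> real \<Rightarrow> nat \<Rightarrow> 'u \<Rightarrow> real" where
  "hamiltonian lam \<theta> c \<phi> t i v = \<theta> * c t i v * \<phi> t i + (\<Sum>j. lam i j v * \<phi> t j)"

definition HJB_solution ::
    "(nat \<Rightarrow> 'u set) \<Rightarrow> (nat \<Rightarrow> nat \<Rightarrow> 'u \<Rightarrow> real) \<Rightarrow> real \<Rightarrow>
     (real \<Rightarrow> nat \<Rightarrow> 'u \<Rightarrow> real) \<Rightarrow> (nat \<Rightarrow> real) \<Rightarrow> real \<Rightarrow> (real \<Rightarrow> nat \<Rightarrow> real) \<Rightarrow> bool" where
  "HJB_solution U lam \<theta> c g T \<phi> \<longleftrightarrow>
     \<phi> \<in> Cb_space T \<inter> C1_space T \<and>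
     (\<forall>t\<in>{0..<T}. \<forall>i. vector_derivative (\<lambda>s. \<phi> s i) (at t within {0..<T})
                        + (INF v\<in>U i. hamiltonian lam \<theta> c \<phi> t i v) = 0) \<and>
     (\<forall>i. \<phi> T i = exp (\<theta> * g i))"

definition minimizing_selector ::
    "(nat \<Rightarrow> 'u set) \<Rightarrow> (nat \<Rightarrow> nat \<Rightarrow> 'u \<Rightarrow> real) \<Rightarrow> real \<Rightarrow>
     (real \<Rightarrow> nat \<Rightarrow> 'u \<Rightarrow> real) \<Rightarrow> real \<Rightarrow> (real \<Rightarrow> nat \<Rightarrow> real) \<Rightarrow> (real \<Rightarrow> nat \<Rightarrow> 'u) \<Rightarrow> bool" where
  "minimizing_selector U lam \<theta> c T \<phi> u \<longleftrightarrow>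
     (\<forall>t\<in>{0..<T}. \<forall>i. (INF v\<in>U i. hamiltonian lam \<theta> c \<phi> t i v)
                        = hamiltonian lam \<theta> c \<phi> t i (u t i))"

end

theory Submission
  imports Defs
begin

text \<open>
  Let \<open>\<phi>\<close> solve the HJB equation, equivalently the integral equation
  \<open>\<phi> t i = e\<^bsup>\<theta> g i\<^esup> + \<integral> (inf of the Hamiltonian) over [t,T]\<close>, which has a solution by Banach's fixed point
  theorem because the Hamiltonian is Lipschitz in \<open>\<phi>\<close> for the supremum norm. Along the controlled
  process, the Feynman-Kac formula expresses the difference between the cost of a control and
  \<open>\<phi>\<close> as the expected integral of \<open>exp (\<integral> \<theta> c)\<close> times (Hamiltonian minus its infimum). This is
  nonnegative, and it vanishes for a minimizing selector. Such a selector exists by a measurable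
  selection argument, so \<open>\<phi>\<close> is the value function, which also gives uniqueness.

  The Feynman-Kac formula is obtained from the martingale problem for time-independent functions by
  telescoping over a partition of mesh \<open>h\<close>: on each cell, freezing the multiplicative functional
  at the left end point costs \<open>O(h\<^sup>2)\<close>, and right-continuity of the paths with dominated
  convergence gives the limit.
\<close>

section \<open>Measurable selection of minimizers\<close>

text \<open>A Markov control is only measurable in time, so neither the generator nor the cost rate
  is continuous in \<open>t\<close>, and neither can be frozen over a cell. Only \<phi> and the
  exponential are frozen; cost rate, time derivative and generator stay under the time integral. The
  telescoping is then exact up to the remainder exp x - 1 - x and martingale increments of mean
  zero. On a cell from \<open>a\<close> to \<open>b\<close> the martingale property is applied to
  the fixed test function \<open>\<phi> a\<close>; this forces the time increment of \<phi> to be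
  read at the state at \<open>b\<close>, so it is right-continuity that recovers the state at an
  intermediate time.

  For the selector, the difficulty is that a compact metric space carries no order singling out one
  minimizer. The set of minimizers is therefore shrunk to a point by minimizing, one after the
  other, the distances to countably many points, each operation preserving measurability of the set
  in its parameter.\<close>

lemma compact_nest_metric:
  fixes F :: "nat \<Rightarrow> 'a::metric_space set"
  assumes K: "compact K" and F: "\<And>n. closed (F n)" "\<And>n. F n \<noteq> {}" "\<And>n. F n \<subseteq> K"
    and mono: "antimono F"
  shows "\<Inter>(range F) \<noteq> {}"
proof -
  have "K \<inter> (\<Inter>n\<in>UNIV. F n) \<noteq> {}"
  proof (rule compact_imp_fip_image[OF K])
    fix I :: "nat set" assume "finite I"
    then have "F (Max (insert 0 I)) \<subseteq> F n" if "n \<in> I" for n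
      using that by (intro antimonoD[OF mono] Max_ge) auto
    then show "K \<inter> (\<Inter>n\<in>I. F n) \<noteq> {}"
      using F(2,3)[of "Max (insert 0 I)"] by blast
  qed (use F in auto)
  then show ?thesis by blast
qed

text \<open>The points are those of finite nets of radius \<open>1 / Suc n\<close>: for distinct
  \<open>v\<close> and \<open>w\<close>, a net point close enough to \<open>v\<close> is strictly
  nearer to \<open>v\<close> than to \<open>w\<close>.\<close>

lemma compact_separating_sequence:
  fixes K :: "'a::metric_space set"
  assumes "compact K"
  obtains d :: "nat \<Rightarrow> 'a"
  where "\<And>v w. v \<in> K \<Longrightarrow> w \<in> K \<Longrightarrow> (\<And>n. dist v (d n) = dist w (d n)) \<Longrightarrow> v = w"
proof -
  have "\<forall>e>0. \<exists>k. finite k \<and> k \<subseteq> K \<and> K \<subseteq> (\<Union>x\<in>k. ball x e)"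
    using assms seq_compact_imp_totally_bounded compact_imp_seq_compact by blast
  then have "\<exists>k. finite k \<and> K \<subseteq> (\<Union>x\<in>k. ball x (1 / real (Suc n)))" for n
    by (metis divide_pos_pos of_nat_0_less_iff zero_less_Suc zero_less_one)
  then obtain k where k: "\<And>n. finite (k n)" "\<And>n. K \<subseteq> (\<Union>x\<in>k n. ball x (1 / real (Suc n)))"
    by metis
  define D where "D = (\<Union>n. k n)"
  have cD: "countable D" unfolding D_def using k(1) by (auto intro: countable_finite)
  show thesis
  proof (rule that[of "from_nat_into D"], rule ccontr)
    fix v w assume vw: "v \<in> K" "w \<in> K"
      and eq: "\<And>n. dist v (from_nat_into D n) = dist w (from_nat_into D n)"
      and "v \<noteq> w"
    obtain n where n: "1 / real (Suc n) < dist v w / 2"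
      using nat_approx_posE[of "dist v w / 2"] \<open>v \<noteq> w\<close> by auto
    obtain x where x: "x \<in> k n" "dist x v < 1 / real (Suc n)" using k(2)[of n] vw by auto
    then have "x \<in> D" by (auto simp: D_def)
    then obtain m where "x = from_nat_into D m" using cD from_nat_into_surj by metis
    then have "dist x w = dist x v" using eq by (metis dist_commute)
    then show False using x n dist_triangle2[of v w x] by (simp add: dist_commute)
  qed
qed

text \<open>A selection theorem of Kuratowski--Ryll-Nardzewski type for compact values.
  Measurability of a set-valued map is expressed by its hit sets: the parameters at which the value
  meets a given closed set.\<close>

lemma compact_measurable_selection:
  fixes A :: "'a \<Rightarrow> 'b::metric_space set"
  assumes K: "compact K"
    and A: "\<And>x. x \<in> space N \<Longrightarrow> A x \<noteq> {}" "\<And>x. x \<in> space N \<Longrightarrow> closed (A x)"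
      "\<And>x. x \<in> space N \<Longrightarrow> A x \<subseteq> K"
    and meas: "\<And>C. closed C \<Longrightarrow> {x \<in> space N. A x \<inter> C \<noteq> {}} \<in> sets N"
  obtains w where "w \<in> N \<rightarrow>\<^sub>M restrict_space borel K" "\<And>x. x \<in> space N \<Longrightarrow> w x \<in> A x"
proof -
  obtain d :: "nat \<Rightarrow> 'b"
    where d: "\<And>v w. v \<in> K \<Longrightarrow> w \<in> K \<Longrightarrow> (\<And>n. dist v (d n) = dist w (d n)) \<Longrightarrow> v = w"
    using compact_separating_sequence[OF K] by blast
  \<comment> \<open>Minimise successively the distances to the points \<open>d n\<close>; a single point survives.\<close>
  define F where "F = rec_nat A (\<lambda>n B x. {v \<in> B x. \<forall>w\<in>B x. dist v (d n) \<le> dist w (d n)})"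
  have F0: "F 0 = A" and FS: "F (Suc n) = (\<lambda>x. {v \<in> F n x. \<forall>w\<in>F n x. dist v (d n) \<le> dist w (d n)})"
    for n
    by (simp_all add: F_def)
  have inv: "closed (F n x) \<and> F n x \<noteq> {} \<and> F n x \<subseteq> K" if x: "x \<in> space N" for n x
  proof (induction n)
    case (Suc n)
    then have cF: "compact (F n x)" using K by (metis Int_absorb1 compact_Int_closed)
    obtain v where v: "v \<in> F n x" "\<And>w. w \<in> F n x \<Longrightarrow> dist v (d n) \<le> dist w (d n)"
      using continuous_attains_inf[OF cF, of "\<lambda>v. dist v (d n)"] Suc continuous_on_dist[OF
        continuous_on_id continuous_on_const]
      by blast
    have "F (Suc n) x = F n x \<inter> (\<Inter>w\<in>F n x. {v. dist v (d n) \<le> dist w (d n)})"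
      by (auto simp: FS)
    moreover have "closed (F n x \<inter> (\<Inter>w\<in>F n x. {v. dist v (d n) \<le> dist w (d n)}))"
      using Suc by (intro closed_Int closed_INT ballI closed_Collect_le continuous_intros) auto
    ultimately show ?case using v Suc by (auto simp: FS)
  qed (use A x F0 in auto)
  have anti: "antimono (\<lambda>n. F n x)" for x
    by (rule antimonoI, rule lift_Suc_antimono_le) (auto simp: FS)
  have cmp: "compact (F n x \<inter> C)" if "x \<in> space N" "closed C" for n x C
  proof -
    have "compact (F n x)" using inv[OF that(1)] K by (metis Int_absorb1 compact_Int_closed)
    then show ?thesis using that(2) by (rule compact_Int_closed)
  qed
  have measF: "{x \<in> space N. F n x \<inter> C \<noteq> {}} \<in> sets N" if "closed C" for n C
    using that
  proof (induction n arbitrary: C)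
    case 0 then show ?case using meas F0 by simp
  next
    case (Suc n)
    let ?B = "\<lambda>q::rat. cball (d n) (of_rat q)"
    \<comment> \<open>The set of nearest points meets \<open>C\<close> iff the minimal distance to
      \<open>d n\<close> over \<open>F n x\<close> is already attained inside \<open>C\<close>.
      Comparing the two minima through rational radii turns this into countably many hit conditions
      for closed sets, to which the induction hypothesis applies.\<close>
    have "F (Suc n) x \<inter> C \<noteq> {} \<longleftrightarrow> (\<forall>q::rat. F n x \<inter> ?B q \<noteq> {} \<longrightarrow> F n x \<inter> (C \<inter> ?B q) \<noteq> {})"
      (is "?l \<longleftrightarrow> ?r") if x: "x \<in> space N" for x
    proof
      assume ?l then obtain v
        where v: "v \<in> C" "v \<in> F n x" "\<And>w. w \<in> F n x \<Longrightarrow> dist v (d n) \<le> dist w (d n)"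
        by (auto simp: FS)
      show ?r
      proof (intro allI impI)
        fix q :: rat assume "F n x \<inter> ?B q \<noteq> {}"
        then obtain w where "w \<in> F n x" "dist w (d n) \<le> of_rat q" by (auto simp: dist_commute)
        then have "v \<in> F n x \<inter> (C \<inter> ?B q)" using v by (force simp: dist_commute)
        then show "F n x \<inter> (C \<inter> ?B q) \<noteq> {}" by blast
      qed
    next
      assume r: ?r
      obtain v0 where v0: "v0 \<in> F n x" using inv[OF x] by blast
      obtain q0 :: rat where "dist v0 (d n) < of_rat q0" using of_rat_dense by (metis gt_ex)
      then have "F n x \<inter> ?B q0 \<noteq> {}" using v0 by (force simp: dist_commute)
      then have "F n x \<inter> C \<noteq> {}" using r by blast
      then obtain v where v: "v \<in> F n x \<inter> C" "\<And>w. w \<in> F n x \<inter> C \<Longrightarrow> dist v (d n) \<le> dist w (d n)"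
        using continuous_attains_inf[OF cmp[OF x Suc.prems], where f="\<lambda>v. dist v (d n)"]
          continuous_on_dist[OF continuous_on_id continuous_on_const] by blast
      have "dist v (d n) \<le> dist w (d n)" if w: "w \<in> F n x" for w
      proof (rule ccontr)
        assume "\<not> ?thesis"
        then obtain q where q: "dist w (d n) < of_rat q" "of_rat q < dist v (d n)"
          using of_rat_dense by (metis not_le)
        then have "F n x \<inter> ?B q \<noteq> {}" using w by (force simp: dist_commute)
        then obtain w' where "w' \<in> F n x \<inter> C" "dist w' (d n) \<le> of_rat q" using r
          by (force simp: dist_commute)
        then show False using v(2)[of w'] q by auto
      qed
      then show ?l using v by (auto simp: FS)
    qed
    then have "{x \<in> space N. F (Suc n) x \<inter> C \<noteq> {}} =
       {x \<in> space N. \<forall>q::rat. x \<in> {x \<in> space N. F n x \<inter> ?B q \<noteq> {}} \<longrightarrow> x \<in> {x \<in> space N. F n x \<inter> (C \<inter>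
         ?B q) \<noteq> {}}}"
      by (intro Collect_cong conj_cong refl) blast
    also have "\<dots> \<in> sets N"
    proof -
      have [measurable]: "{x \<in> space N. F n x \<inter> ?B q \<noteq> {}} \<in> sets N"
        "{x \<in> space N. F n x \<inter> (C \<inter> ?B q) \<noteq> {}} \<in> sets N" for q
        using Suc by (auto intro!: Suc.IH)
      show ?thesis by measurable
    qed
    finally show ?case .
  qed
  define w where "w x = (SOME v. \<forall>n. v \<in> F n x)" for x
  have w: "\<forall>n. w x \<in> F n x" if x: "x \<in> space N" for x
  proof -
    have "\<Inter>(range (\<lambda>n. F n x)) \<noteq> {}"
      by (rule compact_nest_metric[OF K]) (use inv[OF x] anti in auto)
    then have "\<exists>v. \<forall>n. v \<in> F n x" by auto
    then show ?thesis unfolding w_def by (rule someI_ex)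
  qed
  \<comment> \<open>Two survivors both minimize the distance to every \<open>d n\<close>, hence have
    the same distances to all of them.\<close>
  have uniq: "v = w x" if x: "x \<in> space N" and v: "\<And>n. v \<in> F n x" for v x
  proof (rule d)
    show "v \<in> K" "w x \<in> K" using inv[OF x, of 0] v w[OF x] by auto
    fix n
    have "v \<in> F (Suc n) x" "w x \<in> F (Suc n) x" using v w[OF x] by auto
    then show "dist v (d n) = dist (w x) (d n)" unfolding FS by (auto intro: antisym)
  qed
  \<comment> \<open>If every stage meets \<open>C\<close>, compactness gives a survivor in
    \<open>C\<close>, and the survivor is unique. This writes the preimage of \<open>C\<close> as a
    countable intersection of hit sets.\<close>
  have *: "w x \<in> C \<longleftrightarrow> (\<forall>n. F n x \<inter> C \<noteq> {})" if x: "x \<in> space N" and C: "closed C" for x C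
  proof
    assume r: "\<forall>n. F n x \<inter> C \<noteq> {}"
    have "antimono (\<lambda>n. F n x \<inter> C)" using anti[of x] unfolding antimono_def by blast
    then have "\<Inter>(range (\<lambda>n. F n x \<inter> C)) \<noteq> {}"
      by (intro compact_nest_metric[OF K]) (use inv[OF x] r C in auto)
    then obtain v where "\<And>n. v \<in> F n x" "v \<in> C" by auto
    then show "w x \<in> C" using uniq[OF x] by blast
  qed (use w[OF x] in blast)
  have "w \<in> N \<rightarrow>\<^sub>M borel"
  proof (subst borel_eq_closed, rule measurable_measure_of)
    fix C :: "'b set" assume "C \<in> Collect closed"
    then have C: "closed C" by simp
    have [measurable]: "{x \<in> space N. F n x \<inter> C \<noteq> {}} \<in> sets N" for n using measF[OF C] .
    have "w -` C \<inter> space N = {x \<in> space N. \<forall>n. x \<in> {x \<in> space N. F n x \<inter> C \<noteq> {}}}"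
      using *[OF _ C] by auto
    also have "\<dots> \<in> sets N" by measurable
    finally show "w -` C \<inter> space N \<in> sets N" .
  qed auto
  moreover have "w x \<in> K" if "x \<in> space N" for x using inv[OF that, of 0] w[OF that] by auto
  ultimately have "w \<in> N \<rightarrow>\<^sub>M restrict_space borel K"
    by (intro measurable_restrict_space2) auto
  then show thesis using w F0 by (intro that[of w]) (metis)+
qed

text \<open>The infima at two nearby parameters are compared by inserting the minimizer of each into
  the function of the other; uniform continuity on the compact product makes both errors
  small.\<close>

lemma continuous_on_INF_compact:
  fixes f :: "'a::metric_space \<Rightarrow> 'b::metric_space \<Rightarrow> real"
  assumes S: "compact S" and K: "compact K" "K \<noteq> {}"
    and f: "continuous_on (S \<times> K) (\<lambda>(x, v). f x v)"
  shows "continuous_on S (\<lambda>x. INF v\<in>K. f x v)"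
proof -
  have ex: "\<exists>v\<in>K. f x v = (INF v\<in>K. f x v) \<and> (\<forall>w\<in>K. f x v \<le> f x w)" if x: "x \<in> S" for x
  proof -
    have "continuous_on K (\<lambda>v. (\<lambda>(x, v). f x v) (x, v))"
      by (rule continuous_on_compose2[OF f]) (use x in \<open>auto intro!: continuous_intros\<close>)
    then obtain v where "v \<in> K" "\<forall>w\<in>K. f x v \<le> f x w"
      using continuous_attains_inf[OF K, of "f x"] by auto
    then show ?thesis by (intro bexI[of _ v]) (auto intro!: cInf_eq_minimum[symmetric])
  qed
  have uc: "uniformly_continuous_on (S \<times> K) (\<lambda>(x, v). f x v)"
    using compact_uniformly_continuous[OF f] S K compact_Times by blast
  show ?thesis
  proof (rule continuous_on_iff[THEN iffD2], intro ballI allI impI)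
    fix x e assume x: "x \<in> S" and e: "(0::real) < e"
    obtain r where r: "r > 0" "\<And>p q. p \<in> S \<times> K \<Longrightarrow> q \<in> S \<times> K \<Longrightarrow> dist q p < r
      \<Longrightarrow> dist (case q of (x,v) \<Rightarrow> f x v) (case p of (x,v) \<Rightarrow> f x v) < e"
      using uc e unfolding uniformly_continuous_on_def by metis
    have "dist (INF v\<in>K. f y v) (INF v\<in>K. f x v) < e" if y: "y \<in> S" "dist y x < r" for y
    proof -
      obtain v w where v: "v \<in> K" "f x v = (INF v\<in>K. f x v)" "\<forall>w\<in>K. f x v \<le> f x w"
         and w: "w \<in> K" "f y w = (INF v\<in>K. f y v)" "\<forall>v\<in>K. f y w \<le> f y v"
        using ex x y by metis
      have "\<bar>f y v - f x v\<bar> < e" "\<bar>f y w - f x w\<bar> < e"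
        using r(2)[of "(x,v)" "(y,v)"] r(2)[of "(x,w)" "(y,w)"] v w x y
        by (auto simp: dist_Pair_Pair dist_real_def)
      moreover have "f x v \<le> f x w" "f y w \<le> f y v" using v w by auto
      ultimately show ?thesis unfolding v(2)[symmetric] w(2)[symmetric] dist_real_def by linarith
    qed
    then show "\<exists>d>0. \<forall>x'\<in>S. dist x' x < d \<longrightarrow> dist (INF v\<in>K. f x' v) (INF v\<in>K. f x v) < e"
      using r(1) by blast
  qed
qed

text \<open>Here the hit sets are even closed: the graph of the argmin map is closed in a compact
  product, and projections of compact sets are compact.\<close>

lemma measurable_argmin_selection:
  fixes f :: "'a::metric_space \<Rightarrow> 'b::metric_space \<Rightarrow> real"
  assumes S: "compact S" and K: "compact K" "K \<noteq> {}"
    and f: "continuous_on (S \<times> K) (\<lambda>(x, v). f x v)"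
  obtains w where "w \<in> restrict_space borel S \<rightarrow>\<^sub>M restrict_space borel K"
    "\<And>x. x \<in> S \<Longrightarrow> f x (w x) = (INF v\<in>K. f x v)"
proof -
  define A where "A x = {v \<in> K. f x v = (INF v\<in>K. f x v)}" for x
  have fx: "continuous_on K (f x)" if "x \<in> S" for x
  proof -
    have "continuous_on K (\<lambda>v. (\<lambda>(x, v). f x v) (x, v))"
      by (rule continuous_on_compose2[OF f]) (use that in \<open>auto intro!: continuous_intros\<close>)
    then show ?thesis by simp
  qed
  have ne: "A x \<noteq> {}" if x: "x \<in> S" for x
  proof -
    obtain v where "v \<in> K" "\<forall>w\<in>K. f x v \<le> f x w"
      using continuous_attains_inf[OF K fx[OF x]] by auto
    then have "v \<in> A x" by (auto simp: A_def intro!: cInf_eq_minimum[symmetric])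
    then show ?thesis by auto
  qed
  have cl: "closed (A x)" if x: "x \<in> S" for x
    unfolding A_def using fx[OF x] K
    by (intro continuous_closed_preimage_constant compact_imp_closed) auto
  have cm: "continuous_on (S \<times> K) (\<lambda>p. INF v\<in>K. f (fst p) v)"
    by (rule continuous_on_compose2[OF continuous_on_INF_compact[OF S K f]]) (auto intro!:
      continuous_intros)
  have meas: "{x \<in> S. A x \<inter> C \<noteq> {}} \<in> sets (restrict_space borel S)" if C: "closed C" for C
  proof -
    \<comment> \<open>The graph of \<open>A\<close>, cut down to actions in \<open>C\<close>; its
      first projection is the hit set of \<open>C\<close>.\<close>
    let ?G = "{p \<in> S \<times> K. (\<lambda>(x, v). f x v) p - (INF v\<in>K. f (fst p) v) = 0} \<inter> (UNIV \<times> C)"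
    have "closed {p \<in> S \<times> K. (\<lambda>(x, v). f x v) p - (INF v\<in>K. f (fst p) v) = 0}"
      using S K by (intro continuous_closed_preimage_constant continuous_intros f cm
        compact_imp_closed compact_Times)
    then have "closed ?G" using C by (intro closed_Int closed_Times) auto
    moreover have "compact (S \<times> K)" using S K by (intro compact_Times)
    ultimately have "compact ((S \<times> K) \<inter> ?G)" by (rule compact_Int_closed[rotated])
    then have "compact (fst ` ((S \<times> K) \<inter> ?G))" by (intro compact_continuous_image continuous_intros)
    moreover have "{x \<in> S. A x \<inter> C \<noteq> {}} = fst ` ((S \<times> K) \<inter> ?G)"
      by (force simp: A_def image_iff)
    ultimately have "closed {x \<in> S. A x \<inter> C \<noteq> {}}" using compact_imp_closed by metis
    then have "{x \<in> S. A x \<inter> C \<noteq> {}} \<in> sets borel" "S \<inter> space borel \<in> sets borel"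
      using compact_imp_closed[OF S] by auto
    then show ?thesis by (subst sets_restrict_space_iff) auto
  qed
  obtain w where "w \<in> restrict_space borel S \<rightarrow>\<^sub>M restrict_space borel K"
    "\<And>x. x \<in> space (restrict_space borel S) \<Longrightarrow> w x \<in> A x"
    by (rule compact_measurable_selection[OF K(1), of "restrict_space borel S" A])
      (use ne cl meas in \<open>auto simp: space_restrict_space A_def\<close>)
  then show thesis by (intro that[of w]) (auto simp: A_def space_restrict_space)
qed

text \<open>The action space is not assumed second countable, so Borel measurability of the pair of
  \<open>t\<close> and \<open>w t\<close> cannot be taken for granted. Rounding the time argument
  down to a grid leaves countably many functions, each continuous in the action alone; continuity in
  time then gives the limit.\<close>

lemma measurable_Caratheodory:
  fixes f :: "real \<Rightarrow> 'b::metric_space \<Rightarrow> real"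
  assumes f: "continuous_on ({0..} \<times> K) (\<lambda>(t, v). f t v)"
    and w: "w \<in> restrict_space borel {0..} \<rightarrow>\<^sub>M restrict_space borel K"
  shows "(\<lambda>t. f t (w t)) \<in> borel_measurable (restrict_space borel {0..})"
proof (rule borel_measurable_LIMSEQ_metric)
  let ?R = "restrict_space borel {0::real..}"
  let ?a = "\<lambda>n t. real (nat \<lfloor>real (Suc n) * t\<rfloor>) / real (Suc n)"
  fix n
  show "(\<lambda>t. f (?a n t) (w t)) \<in> borel_measurable ?R"
  proof (rule measurable_compose_countable[where f="\<lambda>k t. f (real k / real (Suc n)) (w t)"])
    fix k :: nat
    have "continuous_on K (\<lambda>v. (\<lambda>(t, v). f t v) (real k / real (Suc n), v))"
      by (rule continuous_on_compose2[OF f]) (auto intro!: continuous_intros)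
    then have "continuous_on K (f (real k / real (Suc n)))" by simp
    then have "f (real k / real (Suc n)) \<in> borel_measurable (restrict_space borel K)"
      by (rule borel_measurable_continuous_on_restrict)
    then show "(\<lambda>t. f (real k / real (Suc n)) (w t)) \<in> borel_measurable ?R"
      using w by (rule measurable_compose[rotated])
    have "(\<lambda>t. nat \<lfloor>real (Suc n) * t\<rfloor>) \<in> borel \<rightarrow>\<^sub>M count_space UNIV" by measurable
    then show "(\<lambda>t. nat \<lfloor>real (Suc n) * t\<rfloor>) \<in> ?R \<rightarrow>\<^sub>M count_space UNIV"
      by (rule measurable_restrict_space1)
  qed
next
  fix t :: real assume "t \<in> space (restrict_space borel {0::real..})"
  then have t: "0 \<le> t" by (simp add: space_restrict_space)
  have wt: "w t \<in> K" using measurable_space[OF w, of t] t by (simp add: space_restrict_space)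
  let ?a = "\<lambda>n. real (nat \<lfloor>real (Suc n) * t\<rfloor>) / real (Suc n)"
  have a: "\<bar>?a n - t\<bar> \<le> 1 / real (Suc n)" for n
  proof -
    have "\<bar>real (nat \<lfloor>real (Suc n) * t\<rfloor>) - real (Suc n) * t\<bar> \<le> 1"
      using t by (simp add: of_nat_nat) linarith
    then have "\<bar>real (nat \<lfloor>real (Suc n) * t\<rfloor>) - real (Suc n) * t\<bar> / real (Suc n) \<le> 1 / real (Suc n)"
      by (rule divide_right_mono) simp
    also have "\<bar>real (nat \<lfloor>real (Suc n) * t\<rfloor>) - real (Suc n) * t\<bar> / real (Suc n)
        = \<bar>(real (nat \<lfloor>real (Suc n) * t\<rfloor>) - real (Suc n) * t) / real (Suc n)\<bar>"
      by (subst abs_divide) simp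
    also have "(real (nat \<lfloor>real (Suc n) * t\<rfloor>) - real (Suc n) * t) / real (Suc n) = ?a n - t"
      by (subst diff_divide_distrib) simp
    finally show ?thesis .
  qed
  have "(\<lambda>n. ?a n - t) \<longlonglongrightarrow> 0"
    by (rule Lim_null_comparison[where g="\<lambda>n. 1 / real (Suc n)"])
      (use a LIMSEQ_inverse_real_of_nat in \<open>auto simp: inverse_eq_divide simp del: of_nat_Suc\<close>)
  then have "?a \<longlonglongrightarrow> t" by (rule LIM_zero_cancel)
  then have "(\<lambda>n. (?a n, w t)) \<longlonglongrightarrow> (t, w t)" by (intro tendsto_intros)
  then have "(\<lambda>n. (\<lambda>(t, v). f t v) (?a n, w t)) \<longlonglongrightarrow> (\<lambda>(t, v). f t v) (t, w t)"
    using f t wt by (intro continuous_on_tendsto_compose[OF f]) auto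
  then show "(\<lambda>n. f (?a n) (w t)) \<longlonglongrightarrow> f t (w t)" by simp
qed

section \<open>Path functionals\<close>

lemma space_path_sigma [simp]: "space (path_sigma R) = paths"
  unfolding path_sigma_def by (rule space_measure_of) auto

lemma measurable_path_sigma_eval:
  assumes "r \<in> R"
  shows "(\<lambda>\<omega>. \<omega> r) \<in> path_sigma R \<rightarrow>\<^sub>M count_space UNIV"
proof -
  have "(\<lambda>\<omega>. \<omega> r) -` {j} \<inter> paths \<in> sets (path_sigma R)" for j
  proof -
    have "{\<omega> \<in> paths. \<omega> r = j} \<in> sets (path_sigma R)"
      unfolding path_sigma_def using assms by (intro in_measure_of) auto
    also have "{\<omega> \<in> paths. \<omega> r = j} = (\<lambda>\<omega>. \<omega> r) -` {j} \<inter> paths" by auto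
    finally show ?thesis .
  qed
  then show ?thesis by (subst measurable_count_space_eq2_countable) auto
qed

lemma path_right_constant:
  assumes "\<omega> \<in> paths" "0 \<le> t"
  obtains b where "t < b" "\<And>x. t \<le> x \<Longrightarrow> x < b \<Longrightarrow> \<omega> x = \<omega> t"
proof -
  have "(\<omega> \<longlongrightarrow> \<omega> t) (at_right t)" using assms by (simp add: paths_def)
  then have "\<forall>\<^sub>F x in at_right t. \<omega> x = \<omega> t" by (simp add: tendsto_discrete)
  then obtain b where "t < b" "\<And>x. t < x \<Longrightarrow> x < b \<Longrightarrow> \<omega> x = \<omega> t"
    unfolding eventually_at_right_field by auto
  then show thesis by (intro that[of b]) (metis order_le_less)+
qed

text \<open>Each jump time \<open>t\<close> receives a rational number beyond \<open>t\<close> up to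
  which the path keeps the value it has at \<open>t\<close>. Two jump times cannot share this
  rational, since the path would then be constant from the earlier one through the later
  one.\<close>

lemma path_jumps_countable:
  assumes \<omega>: "\<omega> \<in> paths"
  shows "countable {t. 0 \<le> t \<and> Lim (at_left t) \<omega> \<noteq> \<omega> t}"
proof -
  let ?J = "{t. 0 \<le> t \<and> Lim (at_left t) \<omega> \<noteq> \<omega> t}"
  have "\<exists>q::rat. t < of_rat q \<and> (\<forall>x. t \<le> x \<and> x < of_rat q \<longrightarrow> \<omega> x = \<omega> t)" if t: "t \<in> ?J" for t
  proof -
    obtain b where b: "t < b" "\<And>x. t \<le> x \<Longrightarrow> x < b \<Longrightarrow> \<omega> x = \<omega> t"
      using path_right_constant[OF \<omega>, of t] t by auto
    obtain q where "t < of_rat q" "of_rat q < b" using of_rat_dense[OF b(1)] by auto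
    then show ?thesis by (intro exI[of _ q] conjI allI impI b(2)) auto
  qed
  then have "\<forall>t\<in>?J. \<exists>q::rat. t < of_rat q \<and> (\<forall>x. t \<le> x \<and> x < of_rat q \<longrightarrow> \<omega> x = \<omega> t)" by blast
  from bchoice[OF this] obtain q :: "real \<Rightarrow> rat" where q: "\<And>t. t \<in> ?J \<Longrightarrow> t < of_rat (q t)"
    "\<And>t x. t \<in> ?J \<Longrightarrow> t \<le> x \<Longrightarrow> x < of_rat (q t) \<Longrightarrow> \<omega> x = \<omega> t" by blast
  have no: False if t: "t \<in> ?J" "t' \<in> ?J" "t < t'" "q t = q t'" for t t'
  proof -
    have "t' < of_rat (q t)" using q(1)[OF t(2)] t(4) by simp
    then have eq: "\<omega> x = \<omega> t'" if "t < x" "x < t'" for x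
      using that t(3) by (intro trans[OF q(2)[OF t(1), of x] q(2)[OF t(1), of t', symmetric]])
        linarith+
    then have "\<forall>\<^sub>F x in at_left t'. \<omega> x = \<omega> t'"
      unfolding eventually_at_left_field using t(3) by (intro exI[of _ t]) auto
    then have "(\<omega> \<longlongrightarrow> \<omega> t') (at_left t')" by (rule tendsto_eventually)
    then have "Lim (at_left t') \<omega> = \<omega> t'" by (intro tendsto_Lim) auto
    then show False using t(2) by simp
  qed
  have "inj_on q ?J"
  proof (rule inj_onI)
    fix t t' assume "t \<in> ?J" "t' \<in> ?J" "q t = q t'"
    then show "t = t'" using no[of t t'] no[of t' t] by (cases t t' rule: linorder_cases) auto
  qed
  then show ?thesis by (rule countableI')
qed

text \<open>The two integrands differ only at countably many times, a Lebesgue null set. This lets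
  the control see the current state instead of the left limit.\<close>

lemma path_left_limit_integral:
  fixes f :: "real \<Rightarrow> nat \<Rightarrow> real"
  assumes "\<omega> \<in> paths" "0 \<le> s"
  shows "(LBINT q:{s..t}. f q (Lim (at_left q) \<omega>)) = (LBINT q:{s..t}. f q (\<omega> q))"
  unfolding set_lebesgue_integral_def
  by (rule integral_discrete_difference[OF path_jumps_countable[OF assms(1)]])
     (use assms(2) in \<open>auto split: split_indicator\<close>)

text \<open>Clamping the time to the interval from \<open>s\<close> to \<open>t\<close> gives a
  function on all of the real line that still depends only on states in that interval. This is what
  later makes time integrals adapted.\<close>

lemma measurable_path_joint:
  assumes s: "0 \<le> s" "s \<le> t" and R: "{s..t} \<subseteq> R"
  shows "(\<lambda>(\<omega>, q). \<omega> (max s (min t q))) \<in> path_sigma R \<Otimes>\<^sub>M borel \<rightarrow>\<^sub>M count_space UNIV"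
proof -
  \<comment> \<open>A grid point strictly to the right of \<open>q\<close>, at distance at most
    \<open>1 / Suc n\<close>; rounding down would lead to left limits. The grid takes countably many
    values, so measurability at each fixed time is enough.\<close>
  let ?a = "\<lambda>n q::real. (real_of_int (\<lfloor>real (Suc n) * q\<rfloor> + 1)) / real (Suc n)"
  have "(\<lambda>p. real (fst p (max s (min t (snd p))))) \<in> borel_measurable (path_sigma R \<Otimes>\<^sub>M borel)"
  proof (rule borel_measurable_LIMSEQ_metric)
    fix n
    show "(\<lambda>p. real (fst p (max s (min t (?a n (snd p))))))
      \<in> borel_measurable (path_sigma R \<Otimes>\<^sub>M borel)"
    proof (rule measurable_compose_countable[where g="\<lambda>p. \<lfloor>real (Suc n) * snd p\<rfloor>"
          and f="\<lambda>k p. real (fst p (max s (min t (real_of_int (k + 1) / real (Suc n)))))"])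
      fix k
      have "max s (min t (real_of_int (k + 1) / real (Suc n))) \<in> R" using s R by auto
      from measurable_compose[OF measurable_fst measurable_path_sigma_eval[OF this]]
      have "(\<lambda>p. fst p (max s (min t (real_of_int (k + 1) / real (Suc n)))))
        \<in> path_sigma R \<Otimes>\<^sub>M borel \<rightarrow>\<^sub>M count_space UNIV" .
      then show "(\<lambda>p. real (fst p (max s (min t (real_of_int (k + 1) / real (Suc n))))))
        \<in> borel_measurable (path_sigma R \<Otimes>\<^sub>M borel)"
        by (rule measurable_compose) simp
    next
      show "(\<lambda>p. \<lfloor>real (Suc n) * snd p\<rfloor>) \<in> path_sigma R \<Otimes>\<^sub>M borel \<rightarrow>\<^sub>M count_space UNIV"
        by measurable
    qed
  next
    fix p assume "p \<in> space (path_sigma R \<Otimes>\<^sub>M (borel :: real measure))"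
    then obtain \<omega> q where p: "p = (\<omega>, q)" "\<omega> \<in> paths" by (auto simp: space_pair_measure)
    let ?c = "max s (min t q)"
    obtain b where b: "?c < b" "\<And>x. ?c \<le> x \<Longrightarrow> x < b \<Longrightarrow> \<omega> x = \<omega> ?c"
      using path_right_constant[OF p(2), of ?c] max.coboundedI1[OF s(1)] by blast
    have gt: "q < ?a n q" and le: "?a n q \<le> q + 1 / real (Suc n)" for n
    proof -
      have "real (Suc n) * q < real_of_int (\<lfloor>real (Suc n) * q\<rfloor> + 1)" by linarith
      then show "q < ?a n q" by (subst pos_less_divide_eq) (simp_all add: mult.commute)
      have "real_of_int (\<lfloor>real (Suc n) * q\<rfloor> + 1) \<le> real (Suc n) * q + 1" by linarith
      then have "?a n q \<le> (real (Suc n) * q + 1) / real (Suc n)" by (rule divide_right_mono) simp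
      also have "\<dots> = q + 1 / real (Suc n)" by (subst add_divide_distrib) simp
      finally show "?a n q \<le> q + 1 / real (Suc n)" .
    qed
    have "\<forall>\<^sub>F n in sequentially. 1 / real (Suc n) < b - ?c"
      using LIMSEQ_inverse_real_of_nat b(1) by (intro order_tendstoD) (auto simp: inverse_eq_divide)
    then have "\<forall>\<^sub>F n in sequentially. \<omega> (max s (min t (?a n q))) = \<omega> ?c"
    proof eventually_elim
      case (elim n)
      then show ?case using gt[of n] le[of n]
        by (intro b(2)) (auto simp: max_def min_def split: if_splits)
    qed
    then show "(\<lambda>n. real (fst p (max s (min t (?a n (snd p))))))
      \<longlonglongrightarrow> real (fst p (max s (min t (snd p))))"
      unfolding p by (auto intro!: tendsto_eventually elim: eventually_mono)
  qed
  then have "(\<lambda>p. nat \<lfloor>real (fst p (max s (min t (snd p))))\<rfloor>)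
    \<in> path_sigma R \<Otimes>\<^sub>M borel \<rightarrow>\<^sub>M count_space UNIV"
    by measurable
  then show ?thesis by (simp add: case_prod_beta')
qed

lemma measurable_path_functional:
  fixes h :: "real \<Rightarrow> nat \<Rightarrow> real"
  assumes s: "0 \<le> s" "s \<le> t" and R: "{s..t} \<subseteq> R" and h: "\<And>j. (\<lambda>q. h q j) \<in> borel_measurable borel"
  shows "(\<lambda>(\<omega>, q). h q (\<omega> (max s (min t q)))) \<in> borel_measurable (path_sigma R \<Otimes>\<^sub>M borel)"
proof -
  have "(\<lambda>p. (\<lambda>j p. h (snd p) j) ((\<lambda>(\<omega>, q). \<omega> (max s (min t q))) p) p)
    \<in> borel_measurable (path_sigma R \<Otimes>\<^sub>M borel)"
    using measurable_path_joint[OF s R] by (rule measurable_compose_countable[rotated])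
      (use h in measurable)
  then show ?thesis by (simp add: case_prod_beta')
qed

text \<open>Two choices of \<open>R\<close> matter: \<open>{s..t}\<close> gives adaptedness to the
  filtration, \<open>{0..}\<close> gives measurability for the law itself.\<close>

lemma measurable_path_integral:
  fixes h :: "real \<Rightarrow> nat \<Rightarrow> real"
  assumes s: "0 \<le> s" "s \<le> t" and R: "{s..t} \<subseteq> R" and h: "\<And>j. (\<lambda>q. h q j) \<in> borel_measurable borel"
  shows "(\<lambda>\<omega>. LBINT q:{s..t}. h q (\<omega> q)) \<in> borel_measurable (path_sigma R)"
proof -
  note [measurable] = measurable_path_functional[OF assms]
  have "(\<lambda>\<omega>. LINT q|lborel. indicator {s..t} q *\<^sub>R h q (\<omega> (max s (min t q))))
    \<in> borel_measurable (path_sigma R)"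
    by measurable
  also have "(\<lambda>\<omega>. LINT q|lborel. indicator {s..t} q *\<^sub>R h q (\<omega> (max s (min t q))))
    = (\<lambda>\<omega>. LBINT q:{s..t}. h q (\<omega> q))"
    unfolding set_lebesgue_integral_def
      by (intro ext Bochner_Integration.integral_cong) (auto split: split_indicator)
  finally show ?thesis .
qed

lemma measurable_path_section:
  fixes h :: "real \<Rightarrow> nat \<Rightarrow> real"
  assumes s: "0 \<le> s" and \<omega>: "\<omega> \<in> paths" and h: "\<And>j. (\<lambda>q. h q j) \<in> borel_measurable borel"
  shows "set_borel_measurable borel {s..t} (\<lambda>q. h q (\<omega> q))"
proof (cases "s \<le> t")
  case True
  have "(\<lambda>q. (\<omega>, q)) \<in> borel \<rightarrow>\<^sub>M path_sigma {s..t} \<Otimes>\<^sub>M borel" using \<omega>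
    by (intro measurable_Pair) auto
  from measurable_compose[OF this measurable_path_functional[OF s True order_refl h]]
  have "(\<lambda>q. h q (\<omega> (max s (min t q)))) \<in> borel_measurable borel" by simp
  then have "(\<lambda>q. indicator {s..t} q *\<^sub>R h q (\<omega> (max s (min t q)))) \<in> borel_measurable borel"
    by measurable
  also have "(\<lambda>q. indicator {s..t} q *\<^sub>R h q (\<omega> (max s (min t q))))
    = (\<lambda>q. indicator {s..t} q *\<^sub>R h q (\<omega> q))"
    by (auto split: split_indicator)
  finally show ?thesis by (simp add: set_borel_measurable_def)
qed (simp add: set_borel_measurable_def)

section \<open>Integrals over compact intervals, and the second-order remainder of the
  exponential\<close>

lemma set_integrable_bounded_Icc:
  fixes f :: "real \<Rightarrow> real"
  assumes "set_borel_measurable borel {a..b} f" "\<And>x. x \<in> {a..b} \<Longrightarrow> \<bar>f x\<bar> \<le> C"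
  shows "set_integrable lborel {a..b} f"
  unfolding set_integrable_def
proof (rule Bochner_Integration.integrable_bound)
  show "integrable lborel (\<lambda>x. C * indicator {a..b} x)"
    by (intro integrable_mult_right integrable_real_indicator) (auto simp: emeasure_lborel_Icc_eq)
  show "(\<lambda>x. indicator {a..b} x *\<^sub>R f x) \<in> borel_measurable lborel" using assms(1)
    by (simp add: set_borel_measurable_def)
  show "AE x in lborel. norm (indicator {a..b} x *\<^sub>R f x) \<le> norm (C * indicator {a..b} x)"
    using assms(2) by (intro AE_I2) (force split: split_indicator)
qed

text \<open>A non-integrable function has integral 0 by convention, so the bound holds without
  measurability. It can thus be applied to every function \<open>\<omega>\<close>, whether it is a
  path or not.\<close>

lemma set_integral_bound_Icc:
  fixes f :: "real \<Rightarrow> real"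
  assumes "a \<le> b" "\<And>x. x \<in> {a..b} \<Longrightarrow> \<bar>f x\<bar> \<le> C"
  shows "\<bar>LBINT x:{a..b}. f x\<bar> \<le> C * (b - a)"
proof -
  have "0 \<le> C" using assms(2)[of a] assms(1) by auto
  show ?thesis
  proof (cases "set_integrable lborel {a..b} f")
    case True
    have "norm (LINT x|lborel. indicator {a..b} x *\<^sub>R f x)
      \<le> (LINT x|lborel. C * indicator {a..b} x)"
    proof (rule Bochner_Integration.integral_norm_bound_integral)
      show "integrable lborel (\<lambda>x. C * indicator {a..b} x)"
        by (intro integrable_mult_right integrable_real_indicator) (auto simp:
        emeasure_lborel_Icc_eq)
      show "norm (indicator {a..b} x *\<^sub>R f x) \<le> C * indicator {a..b} x" for x
        using assms(2)[of x] by (auto split: split_indicator)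
    qed (use True in \<open>simp add: set_integrable_def\<close>)
    then show ?thesis using assms(1) by (simp add: set_lebesgue_integral_def)
  next
    case False
    then show ?thesis using assms(1) \<open>0 \<le> C\<close>
      by (simp add: set_lebesgue_integral_def set_integrable_def not_integrable_integral_eq)
  qed
qed

lemma set_integral_split_Icc:
  fixes f :: "real \<Rightarrow> real"
  assumes "s \<le> a" "a \<le> b" "set_integrable lborel {s..b} f"
  shows "(LBINT x:{s..b}. f x) = (LBINT x:{s..a}. f x) + (LBINT x:{a..b}. f x)"
proof -
  have i: "set_integrable lborel {s..a} f" "set_integrable lborel {a..b} f"
    using assms by (auto intro: set_integrable_subset[OF assms(3)])
  have "f integrable_on {s..b}" using set_borel_integral_eq_integral(1)[OF assms(3)] .
  from Henstock_Kurzweil_Integration.integral_combine[OF assms(1,2) this]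
  show ?thesis using set_borel_integral_eq_integral(2)[OF assms(3)]
    set_borel_integral_eq_integral(2)[OF i(1)]
     set_borel_integral_eq_integral(2)[OF i(2)] by simp
qed

text \<open>Both estimates come from \<open>1 + x \<le> exp x\<close>, used at \<open>x\<close> and
  at \<open>-x\<close>. This is the source of the quadratic error on each cell.\<close>

lemma exp_minus_linear_bound:
  fixes x :: real
  shows "\<bar>exp x - 1 - x\<bar> \<le> x\<^sup>2 * exp \<bar>x\<bar>"
proof -
  have lo: "1 + x \<le> exp x" by (rule exp_ge_add_one_self)
  have "(1 - x) * exp x \<le> exp (- x) * exp x" using exp_ge_add_one_self[of "-x"]
    by (intro mult_right_mono) auto
  then have up: "exp x - 1 \<le> x * exp x" by (simp add: exp_minus algebra_simps)
  have "exp x - 1 - x \<le> x * (exp x - 1)" using up by (simp add: algebra_simps)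
  also have "\<dots> \<le> x\<^sup>2 * exp \<bar>x\<bar>"
  proof (cases "0 \<le> x")
    case True
    then have "x * (exp x - 1) \<le> x * (x * exp x)" using up by (intro mult_left_mono) auto
    then show ?thesis using True by (simp add: power2_eq_square mult.assoc)
  next
    case False
    then have "x * (exp x - 1) \<le> x * x" using lo by (intro mult_left_mono_neg) linarith+
    also have "x * x \<le> x * x * exp \<bar>x\<bar>" using mult_left_mono[of 1 "exp \<bar>x\<bar>" "x * x"] by simp
    finally show ?thesis by (simp add: power2_eq_square)
  qed
  finally show ?thesis using abs_of_nonneg[of "exp x - 1 - x"] lo by linarith
qed

section \<open>Rates and generator\<close>

locale controlled_rates =
  fixes U :: "nat \<Rightarrow> 'u::metric_space set"
    and lam :: "nat \<Rightarrow> nat \<Rightarrow> 'u \<Rightarrow> real"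
    and M :: real
  assumes U_compact: "\<And>i. compact (U i)"
    and U_nonempty: "\<And>i. U i \<noteq> {}"
    and rates_nonneg: "\<And>i j v. j \<noteq> i \<Longrightarrow> v \<in> U i \<Longrightarrow> 0 \<le> lam i j v"
    and rates_diag: "\<And>i v. v \<in> U i \<Longrightarrow> lam i i v = - (\<Sum>j. if j = i then 0 else lam i j v)"
    and A1: "\<And>i j. j \<noteq> i \<Longrightarrow> continuous_on (U i) (lam i j)"
    and A2: "\<And>i v. v \<in> U i \<Longrightarrow> - lam i i v \<le> M"
    and A3: "\<And>i. uniformly_convergent_on (U i) (\<lambda>n v. \<Sum>j<n. if j = i then 0 else lam i j v)"
begin

text \<open>The \<open>suminf\<close> in \<open>rates_diag\<close> is informative only for a
  convergent series; the convergence is read off from (A3).\<close>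

lemma off_sums:
  assumes "v \<in> U i"
  shows "(\<lambda>j. if j = i then 0 else lam i j v) sums (- lam i i v)"
proof -
  obtain l where "uniform_limit (U i) (\<lambda>n v. \<Sum>j<n. if j = i then 0 else lam i j v) l sequentially"
    using A3[of i] unfolding uniformly_convergent_on_def by blast
  then have "(\<lambda>n. \<Sum>j<n. if j = i then 0 else lam i j v) \<longlonglongrightarrow> l v"
    using assms by (rule tendsto_uniform_limitI)
  then have "summable (\<lambda>j. if j = i then 0 else lam i j v)" by (auto simp: summable_def sums_def)
  then show ?thesis using rates_diag[OF assms] by (simp add: summable_sums)
qed

lemma off_uniform:
  "uniform_limit (U i) (\<lambda>n v. \<Sum>j<n. if j = i then 0 else lam i j v) (\<lambda>v. - lam i i v) sequentially"
proof -
  obtain l where l: "uniform_limit (U i) (\<lambda>n v. \<Sum>j<n. if j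
    = i then 0 else lam i j v) l sequentially"
    using A3[of i] unfolding uniformly_convergent_on_def by blast
  have "l v = - lam i i v" if "v \<in> U i" for v
    using tendsto_uniform_limitI[OF l that] off_sums[OF that]
      by (auto simp: sums_def intro: LIMSEQ_unique)
  then show ?thesis using l by (subst uniform_limit_cong'[of _ _ _ _ l]) auto
qed

text \<open>Off the diagonal this is (A1); on the diagonal the rate is, up to sign, a uniform limit
  of continuous partial sums.\<close>

lemma lam_continuous: "continuous_on (U i) (lam i j)"
proof (cases "j = i")
  case True
  have off: "continuous_on (U i) (\<lambda>v. if k = i then 0 else lam i k v)" for k
    by (cases "k = i") (auto intro: A1)
  have "continuous_on (U i) (\<lambda>v. - lam i i v)"
    by (rule uniform_limit_theorem[OF _ off_uniform]) (auto intro!: always_eventually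
      continuous_on_sum off)
  then have "continuous_on (U i) (\<lambda>v. - (- lam i i v))" by (rule continuous_on_minus)
  then show ?thesis using True by simp
qed (rule A1)

lemma diag_nonpos:
  assumes "v \<in> U i"
  shows "lam i i v \<le> 0"
proof -
  have "0 \<le> (\<Sum>j. if j = i then 0 else lam i j v)"
    using rates_nonneg[OF _ assms]
      by (intro suminf_nonneg sums_summable[OF off_sums[OF assms]]) auto
  then show ?thesis using rates_diag[OF assms] by simp
qed

lemma M_nonneg: "0 \<le> M"
proof -
  obtain v where "v \<in> U 0" using U_nonempty by blast
  then show ?thesis using A2[of v 0] diag_nonpos[of v 0] by simp
qed

text \<open>The diagonal entry is minus the sum of the others, so it doubles the total mass of the
  row. This explains the constant \<open>2 * M\<close> in all later estimates.\<close>

lemma abs_sums: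
  assumes v: "v \<in> U i"
  shows "(\<lambda>j. \<bar>lam i j v\<bar>) sums (- 2 * lam i i v)"
proof -
  have "(\<lambda>j. if j = i then - lam i i v else 0) sums (- lam i i v)" by (rule sums_single)
  from sums_add[OF off_sums[OF v] this]
  have "(\<lambda>j. (if j = i then 0 else lam i j v) + (if j
    = i then - lam i i v else 0)) sums (- 2 * lam i i v)" by simp
  also have "(\<lambda>j. (if j = i then 0 else lam i j v) + (if j = i then - lam i i v else 0))
    = (\<lambda>j. \<bar>lam i j v\<bar>)"
    using rates_nonneg[OF _ v] diag_nonpos[OF v] by (auto simp: fun_eq_iff)
  finally show ?thesis .
qed

lemma rate_series_summable:
  assumes "v \<in> U i" "\<And>j. \<bar>f j\<bar> \<le> K"
  shows "summable (\<lambda>j. lam i j v * f j)"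
proof (rule summable_comparison_test')
  show "summable (\<lambda>j. \<bar>lam i j v\<bar> * K)" using abs_sums[OF assms(1)]
    by (intro summable_mult2) (rule sums_summable)
  show "norm (lam i j v * f j) \<le> \<bar>lam i j v\<bar> * K" if "0 \<le> j" for j
    using assms(2)[of j] by (simp add: abs_mult mult_left_mono)
qed

lemma rate_series_bound:
  assumes v: "v \<in> U i" and f: "\<And>j. \<bar>f j\<bar> \<le> K"
  shows "\<bar>\<Sum>j. lam i j v * f j\<bar> \<le> 2 * M * K"
proof -
  have K: "0 \<le> K" using f[of 0] by linarith
  have sm: "summable (\<lambda>j. \<bar>lam i j v\<bar> * K)" using abs_sums[OF v]
    by (intro summable_mult2) (rule sums_summable)
  have le: "\<bar>lam i j v * f j\<bar> \<le> \<bar>lam i j v\<bar> * K" for j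
    using f[of j] by (simp add: abs_mult mult_left_mono)
  have sa: "summable (\<lambda>j. \<bar>lam i j v * f j\<bar>)"
    by (rule summable_comparison_test'[OF sm, of 0]) (use le in simp)
  have "\<bar>\<Sum>j. lam i j v * f j\<bar> \<le> (\<Sum>j. \<bar>lam i j v * f j\<bar>)" by (rule summable_rabs[OF sa])
  also have "\<dots> \<le> (\<Sum>j. \<bar>lam i j v\<bar> * K)" using le sa sm by (intro suminf_le)
  also have "\<dots> = (- 2 * lam i i v) * K"
    using sums_unique[OF sums_mult2[OF abs_sums[OF v], of K]] by simp
  also have "\<dots> \<le> 2 * M * K" using A2[OF v] K by (intro mult_right_mono) auto
  finally show ?thesis .
qed

lemma rate_series_diff_bound:
  assumes v: "v \<in> U i" and f: "\<And>j. \<bar>f j\<bar> \<le> K" and h: "\<And>j. \<bar>h j\<bar> \<le> K" and d: "\<And>j. \<bar>f j - h j\<bar> \<le> d"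
  shows "\<bar>(\<Sum>j. lam i j v * f j) - (\<Sum>j. lam i j v * h j)\<bar> \<le> 2 * M * d"
proof -
  have "(\<Sum>j. lam i j v * f j) - (\<Sum>j. lam i j v * h j) = (\<Sum>j. lam i j v * (f j - h j))"
    using suminf_diff[OF rate_series_summable[OF v f] rate_series_summable[OF v h]]
      by (simp add: right_diff_distrib)
  then show ?thesis using rate_series_bound[OF v d] by simp
qed

text \<open>Beyond index \<open>i\<close> the series is dominated by \<open>K\<close> times the tail
  of the off-diagonal rates, which is small uniformly in the action by (A3). The partial sums
  therefore converge uniformly, and joint continuity passes to the limit.\<close>

lemma rate_series_continuous:
  assumes \<phi>: "\<And>j. continuous_on S (\<lambda>t. \<phi> t j)" and K: "\<And>t j. t \<in> S \<Longrightarrow> \<bar>\<phi> t j\<bar> \<le> K"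
  shows "continuous_on (S \<times> U i) (\<lambda>(t, v). \<Sum>j. lam i j v * \<phi> t j)"
proof -
  have K0: "0 \<le> K" if "t \<in> S" for t using K[OF that, of 0] by linarith
  have "uniform_limit (S \<times> U i) (\<lambda>n (t, v). \<Sum>j<n. lam i j v * \<phi> t j) (\<lambda>(t, v). \<Sum>j. lam i j v
    * \<phi> t j) sequentially"
  proof (rule uniform_limitI)
    \<comment> \<open>The tail of the rates is made smaller than
      \<open>e / (\<bar>K\<bar> + 1)\<close>; the added 1 covers \<open>K = 0\<close>.\<close>
    fix e :: real assume e: "0 < e"
    have "\<forall>\<^sub>F n in sequentially. \<forall>v\<in>U i. dist (\<Sum>j<n. if j = i then 0 else lam i j v) (- lam i i v)
      < e / (\<bar>K\<bar> + 1)"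
      using off_uniform[of i] e by (intro uniform_limitD) auto
    then show "\<forall>\<^sub>F n in sequentially. \<forall>p\<in>S \<times> U i. dist ((\<lambda>(t, v). \<Sum>j<n. lam i j v
      * \<phi> t j) p) ((\<lambda>(t, v). \<Sum>j. lam i j v * \<phi> t j) p) < e"
      using eventually_gt_at_top[of i]
    proof eventually_elim
      case (elim n)
      have "dist (\<Sum>j<n. lam i j v * \<phi> t j) (\<Sum>j. lam i j v * \<phi> t j) < e" if t: "t \<in> S"
        and v: "v \<in> U i" for t v
      proof -
        let ?o = "\<lambda>j. if j = i then 0 else lam i j v"
        have so: "summable ?o" using off_sums[OF v] by (rule sums_summable)
        have tail: "(\<Sum>j. ?o (j + n)) = - lam i i v - (\<Sum>j<n. ?o j)"
          using suminf_minus_initial_segment[OF so, of n] sums_unique[OF off_sums[OF v]] by simp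
        have lt: "(\<Sum>j. ?o (j + n)) < e / (\<bar>K\<bar> + 1)" 
        proof -
          have "dist (\<Sum>j<n. ?o j) (- lam i i v) < e / (\<bar>K\<bar> + 1)" using elim(1) v by blast
          then have "- lam i i v - (\<Sum>j<n. ?o j) < e / (\<bar>K\<bar> + 1)" unfolding dist_real_def by linarith
          then show ?thesis unfolding tail .
        qed
        have sf: "summable (\<lambda>j. lam i j v * \<phi> t j)" using rate_series_summable[OF v K[OF t]] .
        \<comment> \<open>Since \<open>n > i\<close>, the tail avoids the diagonal and consists of
          nonnegative rates.\<close>
        have le: "\<bar>lam i (j + n) v * \<phi> t (j + n)\<bar> \<le> ?o (j + n) * K" for j
        proof -
          have "j + n \<noteq> i" using elim(2) by simp
          then show ?thesis using K[OF t, of "j + n"] rates_nonneg[of "j + n" i v] v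
            by (simp add: abs_mult mult_left_mono)
        qed
        have son: "summable (\<lambda>j. ?o (j + n) * K)" using so
          by (intro summable_mult2) (rule summable_ignore_initial_segment)
        have sa: "summable (\<lambda>j. \<bar>lam i (j + n) v * \<phi> t (j + n)\<bar>)"
          by (rule summable_comparison_test'[OF son, of 0]) (use le in simp)
        have "\<bar>\<Sum>j. lam i (j + n) v * \<phi> t (j + n)\<bar> \<le> (\<Sum>j. \<bar>lam i (j + n) v * \<phi> t (j + n)\<bar>)"
          by (rule summable_rabs[OF sa])
        also have "\<dots> \<le> (\<Sum>j. ?o (j + n) * K)" using le sa son by (intro suminf_le)
        also have "\<dots> = (\<Sum>j. ?o (j + n)) * K" using so
          by (intro suminf_mult2[symmetric]) (rule summable_ignore_initial_segment)
        also have "\<dots> \<le> e / (\<bar>K\<bar> + 1) * K" using lt K0[OF t] by (intro mult_right_mono) auto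
        also have "\<dots> < e" using e K0[OF t] by (simp add: field_simps)
        finally show ?thesis using suminf_minus_initial_segment[OF sf, of n]
          by (simp add: dist_real_def)
      qed
      then show ?case by auto
    qed
  qed
  then show ?thesis
  proof (rule uniform_limit_theorem[rotated])
    have l: "continuous_on (S \<times> U i) (\<lambda>p. lam i j (snd p))" for j
      by (rule continuous_on_compose2[OF lam_continuous]) (auto intro!: continuous_intros)
    have p: "continuous_on (S \<times> U i) (\<lambda>p. \<phi> (fst p) j)" for j
      by (rule continuous_on_compose2[OF \<phi>]) (auto intro!: continuous_intros)
    show "\<forall>\<^sub>F n in sequentially. continuous_on (S \<times> U i) (\<lambda>(t, v). \<Sum>j<n. lam i j v * \<phi> t j)"
      by (auto simp: case_prod_beta' intro!: always_eventually continuous_intros l p)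
  qed simp
qed

lemma generator_bound:
  assumes "u t i \<in> U i" "\<And>j. \<bar>f j\<bar> \<le> K"
  shows "\<bar>generator lam u t f i\<bar> \<le> 2 * M * K"
  unfolding generator_def using assms by (rule rate_series_bound)

lemma generator_diff_bound:
  assumes "u t i \<in> U i" "\<And>j. \<bar>f j\<bar> \<le> K" "\<And>j. \<bar>h j\<bar> \<le> K" "\<And>j. \<bar>f j - h j\<bar> \<le> d"
  shows "\<bar>generator lam u t f i - generator lam u t h i\<bar> \<le> 2 * M * d"
  unfolding generator_def using assms by (rule rate_series_diff_bound)

lemma markov_control_in:
  assumes "u \<in> markov_controls U" "0 \<le> t"
  shows "u t i \<in> U i"
  using assms measurable_space[of "\<lambda>t. u t i" "restrict_space borel {0..}"
    "restrict_space borel (U i)" t]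
  by (auto simp: markov_controls_def space_restrict_space)

text \<open>A control is constrained only at times \<open>t \<ge> 0\<close>; the indicator extends
  the function by 0 to a Borel function on the whole line.\<close>

lemma generator_measurable:
  assumes u: "u \<in> markov_controls U"
  shows "(\<lambda>t. indicator {0..} t * generator lam u t f i) \<in> borel_measurable borel"
proof -
  have [measurable]: "(\<lambda>t. lam i j (u t i)) \<in> borel_measurable (restrict_space borel {0..})" for j
  proof -
    have "(\<lambda>t. u t i) \<in> restrict_space borel {0..} \<rightarrow>\<^sub>M restrict_space borel (U i)" using u
      by (auto simp: markov_controls_def)
    from measurable_compose[OF this borel_measurable_continuous_on_restrict[OF lam_continuous]] show
      ?thesis .
  qed
  have "(\<lambda>t. generator lam u t f i) \<in> borel_measurable (restrict_space borel {0..})"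
    unfolding generator_def by measurable
  then show ?thesis using borel_measurable_restrict_space_iff[of "{0::real..}" borel
    "\<lambda>t. generator lam u t f i"] by simp
qed

end

section \<open>The Feynman-Kac formula\<close>

text \<open>A bounded \<open>Z\<close> known at time \<open>a\<close> may be pulled into the
  conditional expectation given \<open>F a\<close>, which turns \<open>Y b\<close> into
  \<open>Y a\<close>.\<close>

lemma martingale_from_orthogonal:
  assumes "prob_space Q" and m: "martingale_from Q s F Y" and ab: "s \<le> a" "a \<le> b"
    and Z: "Z \<in> borel_measurable (F a)" and C: "\<And>\<omega>. \<omega> \<in> space Q \<Longrightarrow> \<bar>Z \<omega>\<bar> \<le> C"
  shows "(\<integral>\<omega>. Z \<omega> * (Y b \<omega> - Y a \<omega>) \<partial>Q) = 0"
proof -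
  interpret prob_space Q by fact
  have sub: "subalgebra Q (F a)" and [measurable]: "Y a \<in> borel_measurable (F a)"
    and Ya: "integrable Q (Y a)"
    using m ab by (auto simp: martingale_from_def)
  have Yb: "integrable Q (Y b)" using m ab by (auto simp: martingale_from_def)
  have ce: "AE \<omega> in Q. real_cond_exp Q (F a) (Y b) \<omega> = Y a \<omega>" using m ab
    by (auto simp: martingale_from_def)
  interpret finite_measure_subalgebra Q "F a" by unfold_locales (rule sub)
  have ZQ: "Z \<in> borel_measurable Q" by (rule measurable_from_subalg[OF sub Z])
  have int: "integrable Q (\<lambda>\<omega>. Z \<omega> * y \<omega>)" if "integrable Q y" for y
  proof (rule Bochner_Integration.integrable_bound[OF integrable_mult_right[OF that, of C]])
    show "(\<lambda>\<omega>. Z \<omega> * y \<omega>) \<in> borel_measurable Q" using ZQ that by measurable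
    show "AE \<omega> in Q. norm (Z \<omega> * y \<omega>) \<le> norm (C * y \<omega>)"
      using C by (intro AE_I2) (force simp: abs_mult intro!: mult_right_mono)
  qed
  have "(\<integral>\<omega>. Z \<omega> * Y b \<omega> \<partial>Q) = (\<integral>\<omega>. Z \<omega> * real_cond_exp Q (F a) (Y b) \<omega> \<partial>Q)"
    using real_cond_exp_intg(2)[OF int[OF Yb] Z] Yb by simp
  also have "\<dots> = (\<integral>\<omega>. Z \<omega> * Y a \<omega> \<partial>Q)"
  proof (rule integral_cong_AE)
    show "(\<lambda>\<omega>. Z \<omega> * real_cond_exp Q (F a) (Y b) \<omega>) \<in> borel_measurable Q" using ZQ by measurable
    show "(\<lambda>\<omega>. Z \<omega> * Y a \<omega>) \<in> borel_measurable Q" using ZQ Ya by measurable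
    show "AE \<omega> in Q. Z \<omega> * real_cond_exp Q (F a) (Y b) \<omega> = Z \<omega> * Y a \<omega>" using ce
      by eventually_elim simp
  qed
  finally show ?thesis using int[OF Ya] int[OF Yb] by (simp add: right_diff_distrib)
qed

text \<open>Half-open cells partition an interval, while the estimates are stated on closed ones;
  the right end point is a null set.\<close>

lemma integral_indicator_Ico_Icc:
  fixes f :: "real \<Rightarrow> real"
  shows "(LINT x|lborel. indicator {a..<b} x * f x) = (LBINT x:{a..b}. f x)"
  unfolding set_lebesgue_integral_def
  by (rule integral_discrete_difference[where X="{b}"]) (auto split: split_indicator)

context controlled_rates
begin

text \<open>With \<kappa> the integral of \<open>k\<close> over the cell, the increment is
  \<open>Z a\<close> times the sum of three terms: (exp \<kappa> - 1) times \<open>\<phi> b\<close>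
  at the final state, the time increment of \<phi> at the final state, and the state increment of
  \<open>\<phi> a\<close>. The second is the integral of \<open>D\<close>; the third is the
  generator integral plus a martingale increment, which vanishes in the mean against
  \<open>Z a\<close>; the first is \<kappa> \<open>\<phi> b\<close> plus a remainder of order
  \<kappa> squared. Only this remainder enters the error.\<close>

lemma feynman_kac_step:
  fixes k D :: "real \<Rightarrow> nat \<Rightarrow> real" and \<phi> :: "real \<Rightarrow> nat \<Rightarrow> real"
  assumes u: "u \<in> markov_controls U" and s: "0 \<le> s" "s \<le> a" "a \<le> b" "b \<le> T"
    and Q: "solves_martingale_problem lam u s i Q"
    and k: "\<And>j. (\<lambda>q. k q j) \<in> borel_measurable borel" and kB: "\<And>q j. \<bar>k q j\<bar> \<le> B"
    and D: "\<And>j. (\<lambda>q. D q j) \<in> borel_measurable borel" and DL: "\<And>q j. \<bar>D q j\<bar> \<le> L"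
    and \<phi>: "\<And>q j. \<bar>\<phi> q j\<bar> \<le> K" and \<phi>D: "\<And>j. \<phi> b j - \<phi> a j = (LBINT q:{a..b}. D q j)"
  defines "Z \<equiv> \<lambda>t \<omega>. exp (LBINT q:{s..t}. k q (\<omega> q))"
  shows "\<bar>(\<integral>\<omega>. Z b \<omega> * \<phi> b (\<omega> b) \<partial>Q) - (\<integral>\<omega>. Z a \<omega> * \<phi> a (\<omega> a) \<partial>Q)
      - (\<integral>\<omega>. (LBINT q:{a..b}. Z a \<omega> * (k q (\<omega> q) * \<phi> b (\<omega> b) + D q (\<omega> b) + generator lam u q (\<phi> a)
        (\<omega> q))) \<partial>Q)\<bar>
     \<le> exp (B * (T - s)) * exp (B * (T - s)) * K * B\<^sup>2 * (b - a)\<^sup>2"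
proof -
  have ps: "prob_space Q" and sQ: "sets Q = sets (path_sigma {0..})"
    and mart: "martingale_from Q s (\<lambda>t. path_sigma {s..t}) (\<lambda>t \<omega>. \<phi> a (\<omega> t)
      - (LBINT r:{s..t}. generator lam u r (\<phi> a) (\<omega> r)))"
    using Q \<phi>[of a] by (auto simp: solves_martingale_problem_def bounded_iff)
  interpret prob_space Q by fact
  have spQ: "space Q = paths" using sets_eq_imp_space_eq[OF sQ] by simp
  have B0: "0 \<le> B" using kB[of 0 0] by linarith
  have K0: "0 \<le> K" using \<phi>[of 0 0] by linarith
  let ?E = "exp (B * (T - s))"
  let ?g = "\<lambda>q j. indicator {0..} q * generator lam u q (\<phi> a) j"
  have g: "(\<lambda>q. ?g q j) \<in> borel_measurable borel" for j by (rule generator_measurable[OF u])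
  have gB: "\<bar>generator lam u q (\<phi> a) j\<bar> \<le> 2 * M * K" if "0 \<le> q" for q j
    using generator_bound[of u q j "\<phi> a" K] markov_control_in[OF u that] \<phi> by blast
  have ev: "(\<lambda>\<omega>. f (\<omega> t)) \<in> borel_measurable Q" if "0 \<le> t" for f :: "nat \<Rightarrow> real" and t
  proof -
    have "(\<lambda>\<omega>. \<omega> t) \<in> Q \<rightarrow>\<^sub>M count_space UNIV"
      using measurable_path_sigma_eval[of t "{0..}"] that sQ by (simp cong: measurable_cong_sets)
    then show ?thesis by (rule measurable_compose) simp
  qed
  have ig: "set_integrable lborel {x..y} (\<lambda>q. generator lam u q (\<phi> a) (\<omega> q))" if "\<omega> \<in> paths" "0 \<le> x"
    for \<omega> x y
  proof -
    have "set_borel_measurable borel {x..y} (\<lambda>q. ?g q (\<omega> q))"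
      by (rule measurable_path_section[OF that(2,1) g])
    then have "set_integrable lborel {x..y} (\<lambda>q. ?g q (\<omega> q))"
      using gB that(2) by (intro set_integrable_bounded_Icc[where C="2 * M * K"]) auto
    then show ?thesis by (rule set_integrable_cong[THEN iffD1, rotated -1]) (use that(2) in auto)
  qed
  have ik: "set_integrable lborel {x..y} (\<lambda>q. k q (\<omega> q))" if "\<omega> \<in> paths" "0 \<le> x" for \<omega> x y
    by (rule set_integrable_bounded_Icc[OF measurable_path_section[OF that(2,1) k] kB])
  have iD: "set_integrable lborel {x..y} (\<lambda>q. D q j)" for x y j
    by (rule set_integrable_bounded_Icc[OF _ DL]) (use D in \<open>simp add: set_borel_measurable_def\<close>)
  have Zm: "Z t \<in> borel_measurable (path_sigma {s..t})" if "s \<le> t" for t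
    unfolding Z_def using measurable_path_integral[OF s(1) that order_refl k] by measurable
  have ZQ: "Z t \<in> borel_measurable Q" if "s \<le> t" for t
  proof -
    have "Z t \<in> borel_measurable (path_sigma {0..})"
      unfolding Z_def using measurable_path_integral[OF s(1) that _ k, of "{0..}"] s
        by (intro borel_measurable_exp measurable_compose[OF _ borel_measurable_exp]) auto
    then show ?thesis using sQ by (simp cong: measurable_cong_sets)
  qed
  have ZB: "\<bar>Z t \<omega>\<bar> \<le> ?E" if "s \<le> t" "t \<le> T" for t \<omega>
  proof -
    have "\<bar>LBINT q:{s..t}. k q (\<omega> q)\<bar> \<le> B * (t - s)" by (rule set_integral_bound_Icc[OF that(1) kB])
    also have "\<dots> \<le> B * (T - s)" using B0 that by (intro mult_left_mono) auto
    finally show ?thesis by (simp add: Z_def)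
  qed
  let ?Y = "\<lambda>t \<omega>. \<phi> a (\<omega> t) - (LBINT r:{s..t}. generator lam u r (\<phi> a) (\<omega> r))"
  let ?J = "\<lambda>\<omega>. LBINT q:{a..b}. Z a \<omega> * (k q (\<omega> q) * \<phi> b (\<omega> b) + D q (\<omega> b)
    + generator lam u q (\<phi> a) (\<omega> q))"
  let ?\<kappa> = "\<lambda>\<omega>. LBINT q:{a..b}. k q (\<omega> q)"
  let ?R = "\<lambda>\<omega>. Z a \<omega> * (exp (?\<kappa> \<omega>) - 1 - ?\<kappa> \<omega>) * \<phi> b (\<omega> b)"
  have J: "?J \<omega> = Z a \<omega> * (?\<kappa> \<omega> * \<phi> b (\<omega> b) + (\<phi> b (\<omega> b) - \<phi> a (\<omega> b))
    + (LBINT q:{a..b}. generator lam u q (\<phi> a) (\<omega> q)))"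
    if \<omega>: "\<omega> \<in> paths" for \<omega>
  proof -
    have a0: "0 \<le> a" using s by simp
    show ?thesis unfolding \<phi>D
      by (subst set_integral_mult_right, subst set_integral_add, intro set_integral_add
        set_integrable_mult_left ik iD \<omega> a0, rule ig[OF \<omega> a0],
         subst set_integral_add, intro set_integrable_mult_left ik \<omega> a0, rule iD, subst
           set_integral_mult_left, rule refl)
  qed
  have dec: "Z b \<omega> * \<phi> b (\<omega> b) - Z a \<omega> * \<phi> a (\<omega> a) = ?J \<omega> + Z a \<omega> * (?Y b \<omega> - ?Y a \<omega>) + ?R \<omega>"
    if \<omega>: "\<omega> \<in> paths" for \<omega>
  proof -
    have "(LBINT q:{s..b}. k q (\<omega> q)) = (LBINT q:{s..a}. k q (\<omega> q)) + ?\<kappa> \<omega>"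
      by (rule set_integral_split_Icc[OF s(2,3) ik[OF \<omega> s(1)]])
    then have Zb: "Z b \<omega> = Z a \<omega> * exp (?\<kappa> \<omega>)" by (simp add: Z_def exp_add)
    have gg: "(LBINT q:{s..b}. generator lam u q (\<phi> a) (\<omega> q))
      = (LBINT q:{s..a}. generator lam u q (\<phi> a) (\<omega> q)) + (LBINT q:{a..b}. generator lam u q (\<phi> a)
      (\<omega> q))"
      by (rule set_integral_split_Icc[OF s(2,3) ig[OF \<omega> s(1)]])
    show ?thesis unfolding J[OF \<omega>] Zb gg by (simp add: algebra_simps)
  qed
  have Yi: "integrable Q (?Y a)" "integrable Q (?Y b)" using mart s
    by (auto simp: martingale_from_def)
  have iYd: "integrable Q (\<lambda>\<omega>. ?Y b \<omega> - ?Y a \<omega>)"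
    by (rule Bochner_Integration.integrable_diff[OF Yi(2,1)])
  have iY: "integrable Q (\<lambda>\<omega>. Z a \<omega> * (?Y b \<omega> - ?Y a \<omega>))"
  proof (rule Bochner_Integration.integrable_bound)
    show "integrable Q (\<lambda>\<omega>. ?E * (?Y b \<omega> - ?Y a \<omega>))" by (intro integrable_mult_right iYd)
    show "(\<lambda>\<omega>. Z a \<omega> * (?Y b \<omega> - ?Y a \<omega>)) \<in> borel_measurable Q"
      by (rule borel_measurable_times[OF ZQ[OF s(2)] borel_measurable_integrable[OF iYd]])
    show "AE \<omega> in Q. norm (Z a \<omega> * (?Y b \<omega> - ?Y a \<omega>)) \<le> norm (?E * (?Y b \<omega> - ?Y a \<omega>))"
      using ZB[of a] s by (intro AE_I2) (simp add: abs_mult mult_right_mono)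
  qed
  have iZ: "integrable Q (\<lambda>\<omega>. Z t \<omega> * \<phi> t (\<omega> t))" if "s \<le> t" "t \<le> T" for t
  proof (rule integrable_const_bound[where B="?E * K"])
    show "(\<lambda>\<omega>. Z t \<omega> * \<phi> t (\<omega> t)) \<in> borel_measurable Q"
      using ZQ[OF that(1)] ev[of t "\<phi> t"] that s by (intro borel_measurable_times) auto
    show "AE \<omega> in Q. norm (Z t \<omega> * \<phi> t (\<omega> t)) \<le> ?E * K"
      using ZB[OF that] \<phi>[of t] by (intro AE_I2) (simp add: abs_mult mult_mono')
  qed
  have \<kappa>B: "\<bar>?\<kappa> \<omega>\<bar> \<le> B * (b - a)" for \<omega> by (rule set_integral_bound_Icc[OF s(3) kB])
  \<comment> \<open>One factor \<open>?E\<close> bounds \<open>Z a\<close>, the other bounds exp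
    \<bar>\<kappa>\<bar> from \<open>exp_minus_linear_bound\<close>.\<close>
  have RB: "\<bar>?R \<omega>\<bar> \<le> ?E * ?E * K * B\<^sup>2 * (b - a)\<^sup>2" for \<omega>
  proof -
    have "\<bar>?\<kappa> \<omega>\<bar>\<^sup>2 \<le> (B * (b - a))\<^sup>2" using \<kappa>B by (intro power_mono) auto
    moreover have "exp \<bar>?\<kappa> \<omega>\<bar> \<le> ?E"
    proof -
      have "B * (b - a) \<le> B * (T - s)" using B0 s by (intro mult_left_mono) auto
      then show ?thesis using \<kappa>B[of \<omega>] by simp
    qed
    ultimately have "\<bar>?\<kappa> \<omega>\<bar>\<^sup>2 * exp \<bar>?\<kappa> \<omega>\<bar> \<le> (B * (b - a))\<^sup>2 * ?E" by (intro mult_mono) auto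
    then have "\<bar>exp (?\<kappa> \<omega>) - 1 - ?\<kappa> \<omega>\<bar> \<le> (B * (b - a))\<^sup>2 * ?E"
      using exp_minus_linear_bound[of "?\<kappa> \<omega>"] by simp
    then have "\<bar>Z a \<omega>\<bar> * \<bar>exp (?\<kappa> \<omega>) - 1 - ?\<kappa> \<omega>\<bar> * \<bar>\<phi> b (\<omega> b)\<bar> \<le> ?E * ((B * (b - a))\<^sup>2 * ?E) * K"
      using ZB[of a \<omega>] \<phi>[of b] s K0 by (intro mult_mono) auto
    then have "\<bar>?R \<omega>\<bar> \<le> ?E * ((B * (b - a))\<^sup>2 * ?E) * K" by (simp only: abs_mult)
    also have "\<dots> = ?E * ?E * K * B\<^sup>2 * (b - a)\<^sup>2" by (simp only: power_mult_distrib ac_simps)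
    finally show ?thesis .
  qed
  have iR: "integrable Q ?R"
  proof (rule integrable_const_bound)
    have "?\<kappa> \<in> borel_measurable Q"
      using measurable_path_integral[of a b "{0..}", OF _ s(3) _ k] s sQ
        by (simp cong: measurable_cong_sets)
    then show "?R \<in> borel_measurable Q"
      using ZQ[OF s(2)] ev[of b "\<phi> b"] s
        by (intro borel_measurable_times borel_measurable_diff borel_measurable_const
        measurable_compose[OF _ borel_measurable_exp]) auto
    show "AE \<omega> in Q. norm (?R \<omega>) \<le> ?E * ?E * K * B\<^sup>2 * (b - a)\<^sup>2" using RB by (intro AE_I2) simp
  qed
  \<comment> \<open>The decomposition expresses \<open>?J\<close> through quantities already known
    to be integrable, which settles measurability and integrability at once.\<close>
  have iJ: "integrable Q ?J"
  proof -
    have "integrable Q (\<lambda>\<omega>. Z b \<omega> * \<phi> b (\<omega> b) - Z a \<omega> * \<phi> a (\<omega> a) - Z a \<omega> * (?Y b \<omega> - ?Y a \<omega>)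
      - ?R \<omega>)"
      using iZ s iY iR by (intro Bochner_Integration.integrable_diff) auto
    then show ?thesis
      by (rule Bochner_Integration.integrable_cong[THEN iffD1, rotated -1]) (use dec spQ in auto)
  qed
  have "(\<integral>\<omega>. Z b \<omega> * \<phi> b (\<omega> b) \<partial>Q) - (\<integral>\<omega>. Z a \<omega> * \<phi> a (\<omega> a) \<partial>Q)
    = (\<integral>\<omega>. Z b \<omega> * \<phi> b (\<omega> b) - Z a \<omega> * \<phi> a (\<omega> a) \<partial>Q)"
    using iZ s by (intro Bochner_Integration.integral_diff[symmetric]) auto
  also have "\<dots> = (\<integral>\<omega>. ?J \<omega> + Z a \<omega> * (?Y b \<omega> - ?Y a \<omega>) + ?R \<omega> \<partial>Q)"
    using dec spQ by (intro Bochner_Integration.integral_cong) auto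
  also have "\<dots> = (\<integral>\<omega>. ?J \<omega> \<partial>Q) + (\<integral>\<omega>. Z a \<omega> * (?Y b \<omega> - ?Y a \<omega>) \<partial>Q) + (\<integral>\<omega>. ?R \<omega> \<partial>Q)"
    using iJ iY iR by (simp only: Bochner_Integration.integral_add
      Bochner_Integration.integrable_add)
  also have "(\<integral>\<omega>. Z a \<omega> * (?Y b \<omega> - ?Y a \<omega>) \<partial>Q) = 0"
    by (rule martingale_from_orthogonal[OF ps mart s(2,3) Zm[OF s(2)] ZB]) (use s in auto)
  finally have "(\<integral>\<omega>. Z b \<omega> * \<phi> b (\<omega> b) \<partial>Q) - (\<integral>\<omega>. Z a \<omega> * \<phi> a (\<omega> a) \<partial>Q) - (\<integral>\<omega>. ?J \<omega> \<partial>Q)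
    = (\<integral>\<omega>. ?R \<omega> \<partial>Q)"
    by simp
  moreover have "\<bar>\<integral>\<omega>. ?R \<omega> \<partial>Q\<bar> \<le> ?E * ?E * K * B\<^sup>2 * (b - a)\<^sup>2"
  proof -
    have "norm (\<integral>\<omega>. ?R \<omega> \<partial>Q) \<le> (\<integral>\<omega>. ?E * ?E * K * B\<^sup>2 * (b - a)\<^sup>2 \<partial>Q)"
      using iR RB by (intro order_trans[OF integral_norm_bound] integral_mono integrable_norm) auto
    then show ?thesis by (simp add: prob_space)
  qed
  ultimately show ?thesis by simp
qed


text \<open>Here \<open>k\<close> and \<open>D\<close> are merely bounded and Borel in time.
  \<open>D\<close> is a density of the time increments of \<phi>, so \<phi> is Lipschitz in time
  with constant \<open>L\<close>; no pointwise derivative enters. The factor \<open>Z\<close> is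
  also Lipschitz along a path, and these two facts control the freezing.\<close>

lemma feynman_kac:
  fixes k D :: "real \<Rightarrow> nat \<Rightarrow> real" and \<phi> :: "real \<Rightarrow> nat \<Rightarrow> real"
  assumes u: "u \<in> markov_controls U" and s: "0 \<le> s" "s \<le> T"
    and Q: "solves_martingale_problem lam u s i Q"
    and k: "\<And>j. (\<lambda>q. k q j) \<in> borel_measurable borel" and kB: "\<And>q j. \<bar>k q j\<bar> \<le> B"
    and D: "\<And>j. (\<lambda>q. D q j) \<in> borel_measurable borel" and DL: "\<And>q j. \<bar>D q j\<bar> \<le> L"
    and \<phi>: "\<And>q j. \<bar>\<phi> q j\<bar> \<le> K"
    and \<phi>D: "\<And>a b j. s \<le> a \<Longrightarrow> a \<le> b \<Longrightarrow> b \<le> T \<Longrightarrow> \<phi> b j - \<phi> a j = (LBINT q:{a..b}. D q j)"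
  defines "Z \<equiv> \<lambda>t \<omega>. exp (LBINT q:{s..t}. k q (\<omega> q))"
  shows "(\<integral>\<omega>. Z T \<omega> * \<phi> T (\<omega> T) \<partial>Q) = \<phi> s i +
     (\<integral>\<omega>. (LBINT q:{s..T}. Z q \<omega> * (k q (\<omega> q) * \<phi> q (\<omega> q) + D q (\<omega> q) + generator lam u q (\<phi> q) (\<omega>
       q))) \<partial>Q)"
proof -
  have ps: "prob_space Q" and sQ: "sets Q = sets (path_sigma {0..})" and start: "AE \<omega> in Q. \<omega> s = i"
    using Q by (auto simp: solves_martingale_problem_def)
  interpret prob_space Q by fact
  have spQ: "space Q = paths" using sets_eq_imp_space_eq[OF sQ] by simp
  have B0: "0 \<le> B" using kB[of 0 0] by linarith
  have K0: "0 \<le> K" using \<phi>[of 0 0] by linarith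
  have L0: "0 \<le> L" using DL[of 0 0] by linarith
  let ?E = "exp (B * (T - s))"
  define C where "C = ?E * (B * K + L + 2 * M * K)"
  have C0: "0 \<le> C" using B0 K0 L0 M_nonneg by (simp add: C_def)
  \<comment> \<open>The clamped path agrees with the path on the interval of interest and is jointly
    measurable on the product with the whole real line.\<close>
  define X where "X \<omega> q = \<omega> (max s (min T q))" for \<omega> :: "real \<Rightarrow> nat" and q
  have X: "X \<omega> q = \<omega> q" if "s \<le> q" "q \<le> T" for \<omega> q using that by (simp add: X_def)
  have ZB: "\<bar>Z t \<omega>\<bar> \<le> ?E" if "s \<le> t" "t \<le> T" for t \<omega>
  proof -
    have "\<bar>LBINT q:{s..t}. k q (\<omega> q)\<bar> \<le> B * (t - s)" by (rule set_integral_bound_Icc[OF that(1) kB])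
    also have "\<dots> \<le> B * (T - s)" using B0 that by (intro mult_left_mono) auto
    finally show ?thesis by (simp add: Z_def)
  qed
  \<comment> \<open>The integrand of one cell, made measurable by \<open>X\<close> and the
    indicator; on the cell it is the integrand of \<open>feynman_kac_step\<close>.\<close>
  define J where "J a b \<omega> q = Z a \<omega> * (k q (X \<omega> q) * \<phi> b (\<omega> b) + D q (\<omega> b) + indicator {0..} q
    * generator lam u q (\<phi> a) (X \<omega> q))"
    for a b \<omega> q
  have JB: "\<bar>J a b \<omega> q\<bar> \<le> C" if "s \<le> a" "a \<le> T" for a b \<omega> q
  proof -
    have "\<bar>k q (X \<omega> q) * \<phi> b (\<omega> b)\<bar> \<le> B * K" using kB[of q] \<phi>[of b] B0
      by (simp add: abs_mult mult_mono)
    moreover have "\<bar>indicator {0..} q * generator lam u q (\<phi> a) (X \<omega> q)\<bar> \<le> 2 * M * K"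
      using generator_bound[of u q "X \<omega> q" "\<phi> a" K] markov_control_in[OF u, of q] \<phi> M_nonneg K0
        by (auto split: split_indicator)
    ultimately have "\<bar>k q (X \<omega> q) * \<phi> b (\<omega> b) + D q (\<omega> b) + indicator {0..} q
      * generator lam u q (\<phi> a) (X \<omega> q)\<bar> \<le> B * K + L + 2 * M * K"
      using DL[of q "\<omega> b"] by linarith
    then show ?thesis unfolding J_def C_def abs_mult using ZB[OF that] by (intro mult_mono) auto
  qed
  let ?P = "Q \<Otimes>\<^sub>M lborel"
  have setsP: "sets ?P = sets (path_sigma {0..} \<Otimes>\<^sub>M borel)"
    by (rule sets_pair_measure_cong) (auto simp: sQ)
  have mX: "(\<lambda>p. h (snd p) (X (fst p) (snd p))) \<in> borel_measurable ?P"
    if "\<And>j. (\<lambda>q. h q j) \<in> borel_measurable borel" for h :: "real \<Rightarrow> nat \<Rightarrow> real"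
  proof -
    have "(\<lambda>(\<omega>, q). h q (X \<omega> q)) \<in> borel_measurable (path_sigma {0..} \<Otimes>\<^sub>M borel)"
      unfolding X_def by (rule measurable_path_functional[OF s _ that]) (use s in auto)
    then have "(\<lambda>(\<omega>, q). h q (X \<omega> q)) \<in> borel_measurable ?P"
      unfolding measurable_cong_sets[OF setsP refl] .
    then show ?thesis by (simp add: case_prod_beta')
  qed
  have mev: "(\<lambda>p. fst p t) \<in> ?P \<rightarrow>\<^sub>M count_space UNIV" if "0 \<le> t" for t
  proof -
    have "(\<lambda>\<omega>. \<omega> t) \<in> Q \<rightarrow>\<^sub>M count_space UNIV"
      using measurable_path_sigma_eval[of t "{0..}"] that sQ by (simp cong: measurable_cong_sets)
    then show ?thesis by (rule measurable_compose[OF measurable_fst])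
  qed
  have mZ: "(\<lambda>p. Z t (fst p)) \<in> borel_measurable ?P" if "s \<le> t" for t
  proof -
    have "(\<lambda>\<omega>. LBINT q:{s..t}. k q (\<omega> q)) \<in> borel_measurable Q"
      using measurable_path_integral[OF s(1) that _ k, of "{0..}"] s sQ
        by (simp cong: measurable_cong_sets)
    then show ?thesis unfolding Z_def by measurable
  qed
  have mJ: "(\<lambda>p. J a b (fst p) (snd p)) \<in> borel_measurable ?P" if ab: "s \<le> a" "a \<le> b" for a b
  proof -
    have b0: "0 \<le> b" using s ab by simp
    have "(\<lambda>p. \<phi> b (fst p b)) \<in> borel_measurable ?P"
      by (rule measurable_compose[OF mev[OF b0]]) simp
    moreover have "(\<lambda>p. (\<lambda>j p. D (snd p) j) (fst p b) p) \<in> borel_measurable ?P"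
      by (rule measurable_compose_countable[OF _ mev[OF b0]], rule measurable_compose[OF
        measurable_snd]) (simp add: D)
    ultimately show ?thesis unfolding J_def using ab
      by (intro borel_measurable_times borel_measurable_add mZ mX[OF k] mX[OF
        generator_measurable[OF u], simplified]) simp_all
  qed
  define t where "t n j = s + real j * ((T - s) / real (Suc n))" for n j
  have t0: "t n 0 = s" and tn: "t n (Suc n) = T" for n by (simp_all add: t_def)
  have tmono: "t n j \<le> t n j'" if "j \<le> j'" for n j j'
    unfolding t_def using that s by (intro add_left_mono mult_right_mono) auto
  have tin: "s \<le> t n j" "j \<le> Suc n \<Longrightarrow> t n j \<le> T" for n j
    using tmono[of 0 j n] tmono[of j "Suc n" n] t0 tn by auto
  have tdiff: "t n (Suc j) - t n j = (T - s) / real (Suc n)" for n j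
  proof -
    have "s + real (Suc j) * h - (s + real j * h) = h" for h by (simp add: algebra_simps)
    then show ?thesis unfolding t_def .
  qed
  \<comment> \<open>All cell integrands glued into one function of time. Half-open cells put each
    time of \<open>{s..<T}\<close> into exactly one of them.\<close>
  define I where "I n \<omega> q = (\<Sum>j<Suc n. indicator {t n j..<t n (Suc j)} q
    * J (t n j) (t n (Suc j)) \<omega> q)" for n \<omega> q
  have cell: "\<exists>j<Suc n. t n j \<le> q \<and> q < t n (Suc j) \<and> (\<forall>\<omega>. I n \<omega> q = J (t n j) (t n (Suc j)) \<omega> q)"
    if q: "q \<in> {s..<T}" for n q
  proof -
    let ?Q = "\<lambda>j. q < t n (Suc j)"
    define j where "j = (LEAST j. ?Q j)"
    have "?Q n" using q tn by simp
    then have j: "?Q j" "j \<le> n" unfolding j_def by (rule LeastI, rule Least_le)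
    have lo: "t n j \<le> q"
    proof (cases j)
      case 0 then show ?thesis using q t0 by simp
    next
      case (Suc m)
      then have "\<not> ?Q m" using not_less_Least[of m ?Q] unfolding j_def[symmetric] by simp
      then show ?thesis using Suc by simp
    qed
    have "indicator {t n l..<t n (Suc l)} q = (if l = j then 1 else 0 :: real)" for l
    proof -
      have "t n (Suc l) \<le> q" if "l < j" using tmono[of "Suc l" j n] lo that by simp
      moreover have "q < t n l" if "j < l" using tmono[of "Suc j" l n] j that by simp
      ultimately show ?thesis using lo j
        by (cases l j rule: linorder_cases) (auto simp: indicator_def not_less)
    qed
    then have "I n \<omega> q = J (t n j) (t n (Suc j)) \<omega> q" for \<omega>
      using j(2) by (simp add: I_def if_distrib[of "\<lambda>x. x * _"] cong: if_cong del: sum.lessThan_Suc)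
    then show ?thesis using lo j by (intro exI[of _ j]) auto
  qed
  have out: "I n \<omega> q = 0" if "q \<notin> {s..<T}" for n \<omega> q
  proof -
    have "q \<notin> {t n j..<t n (Suc j)}" if "j < Suc n" for j
      using tin(1)[of n j] tin(2)[of "Suc j" n] that \<open>q \<notin> {s..<T}\<close> by auto
    then show ?thesis unfolding I_def by (intro sum.neutral) auto
  qed
  have IB: "\<bar>I n \<omega> q\<bar> \<le> C * indicator {s..T} q" for n \<omega> q
  proof (cases "q \<in> {s..<T}")
    case True
    obtain j where "j < Suc n" "I n \<omega> q = J (t n j) (t n (Suc j)) \<omega> q" using cell[OF True, of n]
      by blast
    then show ?thesis using True JB[OF tin(1) tin(2), of j n "t n (Suc j)" \<omega> q] by simp
  qed (use out C0 in simp)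
  have mI: "(\<lambda>p. I n (fst p) (snd p)) \<in> borel_measurable ?P" for n
    unfolding I_def
    by (intro borel_measurable_sum borel_measurable_times mJ tin(1) tmono measurable_compose[OF
      measurable_snd]) auto
  have sec: "(\<lambda>q. f (\<omega>, q)) \<in> borel_measurable lborel" if "f \<in> borel_measurable ?P" "\<omega> \<in> paths"
    for f :: "_ \<Rightarrow> real" and \<omega>
    by (rule measurable_compose[OF _ that(1)]) (use that spQ in \<open>auto intro!: measurable_Pair\<close>)
  define G where "G \<omega> q = Z q \<omega> * (k q (\<omega> q) * \<phi> q (\<omega> q) + D q (\<omega> q)
    + generator lam u q (\<phi> q) (\<omega> q))" for \<omega> q
  have inter: "\<bar>\<phi> b j - \<phi> a j\<bar> \<le> L * (b - a)" if "s \<le> a" "a \<le> b" "b \<le> T" for a b j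
    unfolding \<phi>D[OF that] by (rule set_integral_bound_Icc[OF that(2) DL])
  \<comment> \<open>As the mesh shrinks, the end points of the cell containing \<open>q\<close>
    close in on \<open>q\<close>, with \<open>q\<close> strictly below the right one. The terms
    \<open>k\<close>, \<open>D\<close> and the control are already taken at time \<open>q\<close>,
    so only \<phi>, \<open>Z\<close> and the state have to converge.\<close>
  have limI: "(\<lambda>n. I n \<omega> q) \<longlonglongrightarrow> indicator {s..<T} q * G \<omega> q" if \<omega>: "\<omega> \<in> paths" for \<omega> q
  proof (cases "q \<in> {s..<T}")
    case True
    then have q: "s \<le> q" "q < T" "0 \<le> q" using s by auto
    have "\<forall>n. \<exists>j<Suc n. t n j \<le> q \<and> q < t n (Suc j) \<and> (\<forall>\<omega>. I n \<omega> q = J (t n j) (t n (Suc j)) \<omega> q)"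
      using cell[OF True] by blast
    from choice[OF this] obtain j
      where j: "\<And>n. j n < Suc n" "\<And>n. t n (j n) \<le> q" "\<And>n. q < t n (Suc (j n))"
      "\<And>n. I n \<omega> q = J (t n (j n)) (t n (Suc (j n))) \<omega> q" by blast
    define a where "a n = t n (j n)" for n
    define b where "b n = t n (Suc (j n))" for n
    have a: "s \<le> a n" "a n \<le> q" and b: "q < b n" "b n \<le> T" for n
      using j(1)[of n] j(2)[of n] j(3)[of n] tin(1)[of n "j n"] tin(2)[of "Suc (j n)" n]
        by (auto simp: a_def b_def)
    have ba: "b n - a n = (T - s) / real (Suc n)" for n unfolding a_def b_def by (rule tdiff)
    have h0: "(\<lambda>n. (T - s) / real (Suc n)) \<longlonglongrightarrow> 0"
      using tendsto_mult_left[OF LIMSEQ_inverse_real_of_nat, of "T - s"]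
        by (simp add: divide_inverse)
    have qa: "(\<lambda>n. q - a n) \<longlonglongrightarrow> 0"
    proof (rule tendsto_sandwich[OF _ _ tendsto_const h0])
      show "\<forall>\<^sub>F n in sequentially. 0 \<le> q - a n" using a by simp
      show "\<forall>\<^sub>F n in sequentially. q - a n \<le> (T - s) / real (Suc n)"
        unfolding ba[symmetric] using b(1) by (intro always_eventually allI) (simp add: less_imp_le)
    qed
    have bq: "(\<lambda>n. b n - q) \<longlonglongrightarrow> 0"
    proof (rule tendsto_sandwich[OF _ _ tendsto_const h0])
      show "\<forall>\<^sub>F n in sequentially. 0 \<le> b n - q" using b(1)
        by (intro always_eventually allI) (simp add: less_imp_le)
      show "\<forall>\<^sub>F n in sequentially. b n - q \<le> (T - s) / real (Suc n)"
        unfolding ba[symmetric] using a(2) by (intro always_eventually allI) simp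
    qed
    have Zl: "(\<lambda>n. Z (a n) \<omega>) \<longlonglongrightarrow> Z q \<omega>"
    proof -
      have ik: "set_integrable lborel {s..q} (\<lambda>q. k q (\<omega> q))"
        by (rule set_integrable_bounded_Icc[OF measurable_path_section[OF s(1) \<omega> k] kB])
      have "(\<lambda>n. (LBINT r:{s..a n}. k r (\<omega> r)) - (LBINT r:{s..q}. k r (\<omega> r))) \<longlonglongrightarrow> 0"
      proof (rule Lim_null_comparison[where g="\<lambda>n. B * (q - a n)"])
        show "\<forall>\<^sub>F n in sequentially. norm ((LBINT r:{s..a n}. k r (\<omega> r))
          - (LBINT r:{s..q}. k r (\<omega> r))) \<le> B * (q - a n)"
        proof (intro always_eventually allI)
          fix n
          have "\<bar>LBINT r:{a n..q}. k r (\<omega> r)\<bar> \<le> B * (q - a n)" using a(2) kB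
            by (rule set_integral_bound_Icc)
          then show "norm ((LBINT r:{s..a n}. k r (\<omega> r)) - (LBINT r:{s..q}. k r (\<omega> r)))
            \<le> B * (q - a n)"
            unfolding set_integral_split_Icc[OF a(1)[of n] a(2)[of n] ik] by simp
        qed
        show "(\<lambda>n. B * (q - a n)) \<longlonglongrightarrow> 0" using tendsto_mult_right_zero[OF qa] .
      qed
      then show ?thesis unfolding Z_def by (rule tendsto_exp[OF LIM_zero_cancel])
    qed
    \<comment> \<open>The right end points eventually enter an interval on which the path keeps its
      value at \<open>q\<close>, so the state there is eventually equal to, not just close to, the
      state at \<open>q\<close>.\<close>
    obtain d where d: "q < d" "\<And>x. q \<le> x \<Longrightarrow> x < d \<Longrightarrow> \<omega> x = \<omega> q" 
    proof (rule path_right_constant[OF \<omega> q(3)])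
      fix b assume "q < b" and *: "\<And>x. q \<le> x \<Longrightarrow> x < b \<Longrightarrow> \<omega> x = \<omega> q"
      show thesis by (rule that[OF \<open>q < b\<close>]) (rule *)
    qed
    have "\<forall>\<^sub>F n in sequentially. b n - q < d - q" by (rule order_tendstoD(2)[OF bq]) (use d in simp)
    then have \<omega>b: "\<forall>\<^sub>F n in sequentially. \<omega> (b n) = \<omega> q"
    proof eventually_elim
      case (elim n)
      then show ?case using b(1)[of n] by (intro d(2)) auto
    qed
    have \<phi>l: "(\<lambda>n. \<phi> (b n) (\<omega> q)) \<longlonglongrightarrow> \<phi> q (\<omega> q)"
    proof (rule LIM_zero_cancel, rule Lim_null_comparison[where g="\<lambda>n. L * (b n - q)"])
      show "\<forall>\<^sub>F n in sequentially. norm (\<phi> (b n) (\<omega> q) - \<phi> q (\<omega> q)) \<le> L * (b n - q)"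
        using inter[OF q(1) _ b(2)] b(1) by (intro always_eventually allI) (simp add: less_imp_le)
      show "(\<lambda>n. L * (b n - q)) \<longlonglongrightarrow> 0" using tendsto_mult_right_zero[OF bq] .
    qed
    have gl: "(\<lambda>n. generator lam u q (\<phi> (a n)) (\<omega> q)) \<longlonglongrightarrow> generator lam u q (\<phi> q) (\<omega> q)"
    proof (rule LIM_zero_cancel, rule Lim_null_comparison[where g="\<lambda>n. 2 * M * (L * (q - a n))"])
      have "\<bar>generator lam u q (\<phi> (a n)) (\<omega> q) - generator lam u q (\<phi> q) (\<omega> q)\<bar>
        \<le> 2 * M * (L * (q - a n))" for n
      proof (rule generator_diff_bound[where K=K])
        show "u q (\<omega> q) \<in> U (\<omega> q)" by (rule markov_control_in[OF u q(3)])
        show "\<bar>\<phi> (a n) j - \<phi> q j\<bar> \<le> L * (q - a n)" for j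
          using inter[OF a(1)[of n] a(2)[of n], of j] q by (simp add: abs_minus_commute)
      qed (rule \<phi>)+
      then show "\<forall>\<^sub>F n in sequentially. norm (generator lam u q (\<phi> (a n)) (\<omega> q)
        - generator lam u q (\<phi> q) (\<omega> q)) \<le> 2 * M * (L * (q - a n))"
        by (intro always_eventually allI) simp
      show "(\<lambda>n. 2 * M * (L * (q - a n))) \<longlonglongrightarrow> 0" by (intro tendsto_mult_right_zero qa)
    qed
    have Xq: "X \<omega> q = \<omega> q" using X q by simp
    have "(\<lambda>n. Z (a n) \<omega> * (k q (\<omega> q) * \<phi> (b n) (\<omega> q) + D q (\<omega> q)
      + generator lam u q (\<phi> (a n)) (\<omega> q))) \<longlonglongrightarrow> G \<omega> q"
      unfolding G_def by (intro tendsto_intros Zl \<phi>l gl)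
    then have "(\<lambda>n. I n \<omega> q) \<longlonglongrightarrow> G \<omega> q"
    proof (rule Lim_transform_eventually)
      show "\<forall>\<^sub>F n in sequentially. Z (a n) \<omega> * (k q (\<omega> q) * \<phi> (b n) (\<omega> q) + D q (\<omega> q)
        + generator lam u q (\<phi> (a n)) (\<omega> q)) = I n \<omega> q"
        using \<omega>b
      proof eventually_elim
        case (elim n)
        have "I n \<omega> q = J (a n) (b n) \<omega> q" using j(4) by (simp add: a_def b_def)
        then show ?case using q(3) by (simp only: J_def Xq elim) simp
      qed
    qed
    then show ?thesis using True by simp
  qed (use out in simp)
  define F where "F r = (\<integral>\<omega>. Z r \<omega> * \<phi> r (\<omega> r) \<partial>Q)" for r
  define CC where "CC = ?E * ?E * K * B\<^sup>2"
  have EI: "(\<integral>\<omega>. (LINT q|lborel. I n \<omega> q) \<partial>Q) = (\<Sum>j<Suc n. \<integral>\<omega>. (LBINT q:{t n j..t n (Suc j)}.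
        Z (t n j) \<omega> * (k q (\<omega> q) * \<phi> (t n (Suc j)) (\<omega> (t n (Suc j))) + D q (\<omega> (t n (Suc j))) +
          generator lam u q (\<phi> (t n j)) (\<omega> q))) \<partial>Q)" for n
  proof -
    let ?c = "\<lambda>j \<omega> q. indicator {t n j..<t n (Suc j)} q * J (t n j) (t n (Suc j)) \<omega> q"
    have mc: "(\<lambda>p. ?c j (fst p) (snd p)) \<in> borel_measurable ?P" for j
      by (intro borel_measurable_times mJ tin(1) tmono measurable_compose[OF measurable_snd]) auto
    have bc: "\<bar>?c j \<omega> q\<bar> \<le> C * indicator {s..T} q" if "j < Suc n" for j \<omega> q
      using JB[OF tin(1) tin(2), of j n "t n (Suc j)" \<omega> q] that tin(1)[of n j] tin(2)[of "Suc j" n]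
        C0
      by (auto split: split_indicator)
    have ic: "integrable lborel (?c j \<omega>)" if "\<omega> \<in> paths" "j < Suc n" for \<omega> j
    proof (rule Bochner_Integration.integrable_bound)
      show "integrable lborel (\<lambda>q. C * indicator {s..T} q)"
        by (intro integrable_mult_right integrable_real_indicator) (auto simp:
        emeasure_lborel_Icc_eq)
      show "?c j \<omega> \<in> borel_measurable lborel" using sec[OF mc that(1)] by simp
      show "AE q in lborel. norm (?c j \<omega> q) \<le> norm (C * indicator {s..T} q)" using bc[OF that(2)] C0
        by (intro AE_I2) simp
    qed
    have iic: "integrable Q (\<lambda>\<omega>. LINT q|lborel. ?c j \<omega> q)" if "j < Suc n" for j
    proof (rule integrable_const_bound)
      have "(\<lambda>(\<omega>, q). ?c j \<omega> q) \<in> borel_measurable ?P" using mc by (simp add: case_prod_beta')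
      then show "(\<lambda>\<omega>. LINT q|lborel. ?c j \<omega> q) \<in> borel_measurable Q"
        by (rule lborel.borel_measurable_lebesgue_integral)
      show "AE \<omega> in Q. norm (LINT q|lborel. ?c j \<omega> q) \<le> (LINT q|lborel. C * indicator {s..T} q)"
      proof (rule AE_I2)
        fix \<omega> assume "\<omega> \<in> space Q"
        then show "norm (LINT q|lborel. ?c j \<omega> q) \<le> (LINT q|lborel. C * indicator {s..T} q)"
          using bc[OF that] spQ
            by (intro Bochner_Integration.integral_norm_bound_integral ic[OF _ that]
            integrable_mult_right integrable_real_indicator)
            (auto simp: emeasure_lborel_Icc_eq)
      qed
    qed
    have "(\<integral>\<omega>. (LINT q|lborel. I n \<omega> q) \<partial>Q) = (\<integral>\<omega>. (\<Sum>j<Suc n. LINT q|lborel. ?c j \<omega> q) \<partial>Q)"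
      unfolding I_def using ic spQ
        by (intro Bochner_Integration.integral_cong refl Bochner_Integration.integral_sum) auto
    also have "\<dots> = (\<Sum>j<Suc n. \<integral>\<omega>. (LINT q|lborel. ?c j \<omega> q) \<partial>Q)" using iic
      by (intro Bochner_Integration.integral_sum) auto
    also have "\<dots> = (\<Sum>j<Suc n. \<integral>\<omega>. (LBINT q:{t n j..t n (Suc j)}. J (t n j) (t n (Suc j)) \<omega> q) \<partial>Q)"
      unfolding integral_indicator_Ico_Icc ..
    also have "\<dots> = (\<Sum>j<Suc n. \<integral>\<omega>. (LBINT q:{t n j..t n (Suc j)}.
        Z (t n j) \<omega> * (k q (\<omega> q) * \<phi> (t n (Suc j)) (\<omega> (t n (Suc j))) + D q (\<omega> (t n (Suc j))) +
          generator lam u q (\<phi> (t n j)) (\<omega> q))) \<partial>Q)"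
    proof (intro sum.cong refl Bochner_Integration.integral_cong set_lebesgue_integral_cong allI
      impI)
      fix j \<omega> q assume "j \<in> {..<Suc n}" and q: "q \<in> {t n j..t n (Suc j)}"
      then have "s \<le> q" "q \<le> T" using tin(1)[of n j] tin(2)[of "Suc j" n] by auto
      then show "J (t n j) (t n (Suc j)) \<omega> q = Z (t n j) \<omega> * (k q (\<omega> q)
        * \<phi> (t n (Suc j)) (\<omega> (t n (Suc j))) + D q (\<omega> (t n (Suc j))) + generator lam u q (\<phi> (t n j))
        (\<omega> q))"
        using s by (simp add: J_def X)
    qed simp
    finally show ?thesis .
  qed
  \<comment> \<open>There are \<open>Suc n\<close> cells, each with an error of order
    \<open>1 / (Suc n)\<^sup>2\<close>.\<close>
  have err: "\<bar>F T - F s - (\<integral>\<omega>. (LINT q|lborel. I n \<omega> q) \<partial>Q)\<bar> \<le> CC * (T - s)\<^sup>2 / real (Suc n)" for n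
  proof -
    let ?S = "\<lambda>j. \<integral>\<omega>. (LBINT q:{t n j..t n (Suc j)}.
        Z (t n j) \<omega> * (k q (\<omega> q) * \<phi> (t n (Suc j)) (\<omega> (t n (Suc j))) + D q (\<omega> (t n (Suc j))) +
          generator lam u q (\<phi> (t n j)) (\<omega> q))) \<partial>Q"
    have st: "\<bar>F (t n (Suc j)) - F (t n j) - ?S j\<bar> \<le> CC * ((T - s) / real (Suc n))\<^sup>2" if "j < Suc n"
      for j
    proof -
      have p: "s \<le> t n j" "t n j \<le> t n (Suc j)" "t n (Suc j) \<le> T"
        using tin that tmono[of j "Suc j" n] by auto
      show ?thesis
        using feynman_kac_step[OF u s(1) p Q k kB D DL \<phi> \<phi>D[OF p]]
          unfolding F_def CC_def Z_def tdiff .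
    qed
    have "F T - F s = (\<Sum>j<Suc n. F (t n (Suc j)) - F (t n j))"
      using sum_lessThan_telescope[of "\<lambda>j. F (t n j)" "Suc n"] t0 tn by simp
    then have "\<bar>F T - F s - (\<integral>\<omega>. (LINT q|lborel. I n \<omega> q) \<partial>Q)\<bar>
      = \<bar>\<Sum>j<Suc n. F (t n (Suc j)) - F (t n j) - ?S j\<bar>"
      unfolding EI by (simp only: sum_subtractf)
    also have "\<dots> \<le> (\<Sum>j<Suc n. \<bar>F (t n (Suc j)) - F (t n j) - ?S j\<bar>)" by (rule sum_abs)
    also have "\<dots> \<le> (\<Sum>j<Suc n. CC * ((T - s) / real (Suc n))\<^sup>2)" by (rule sum_mono) (use st in simp)
    also have "\<dots> = real (Suc n) * (CC * ((T - s) / real (Suc n))\<^sup>2)"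
      by (subst sum_constant) (simp only: card_lessThan)
    also have "\<dots> = CC * (T - s)\<^sup>2 / real (Suc n)"
      by (simp add: power_divide power2_eq_square del: of_nat_Suc)
    finally show ?thesis .
  qed
  have l1: "(\<lambda>n. F T - F s - (\<integral>\<omega>. (LINT q|lborel. I n \<omega> q) \<partial>Q)) \<longlonglongrightarrow> 0"
  proof (rule Lim_null_comparison)
    show "\<forall>\<^sub>F n in sequentially. norm (F T - F s - (\<integral>\<omega>. (LINT q|lborel. I n \<omega> q) \<partial>Q))
      \<le> CC * (T - s)\<^sup>2 / real (Suc n)"
      unfolding real_norm_def by (rule always_eventually) (use err in blast)
    show "(\<lambda>n. CC * (T - s)\<^sup>2 / real (Suc n)) \<longlonglongrightarrow> 0"
      using tendsto_mult_left[OF LIMSEQ_inverse_real_of_nat, of "CC * (T - s)\<^sup>2"]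
        by (simp add: divide_inverse)
  qed
  \<comment> \<open>Dominated convergence in time along a fixed path; \<open>l2\<close> repeats it
    over the paths. In both, measurability of the limit is inherited from the
    approximations.\<close>
  have lim\<omega>: "(\<lambda>n. LINT q|lborel. I n \<omega> q) \<longlonglongrightarrow> (LINT q|lborel. indicator {s..<T} q * G \<omega> q)"
    if \<omega>: "\<omega> \<in> paths" for \<omega>
  proof (rule integral_dominated_convergence)
    have mIn: "I n \<omega> \<in> borel_measurable lborel" for n using sec[OF mI \<omega>] by simp
    show "I n \<omega> \<in> borel_measurable lborel" for n by (rule mIn)
    show "(\<lambda>q. indicator {s..<T} q * G \<omega> q) \<in> borel_measurable lborel"
      by (rule borel_measurable_LIMSEQ_metric[OF mIn limI[OF \<omega>]])
    show "integrable lborel (\<lambda>q. C * indicator {s..T} q)"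
      by (intro integrable_mult_right integrable_real_indicator) (auto simp: emeasure_lborel_Icc_eq)
    show "AE q in lborel. (\<lambda>n. I n \<omega> q) \<longlonglongrightarrow> indicator {s..<T} q * G \<omega> q" using limI[OF \<omega>] by simp
    show "AE q in lborel. norm (I n \<omega> q) \<le> C * indicator {s..T} q" for n using IB by simp
  qed
  have IiB: "\<bar>LINT q|lborel. I n \<omega> q\<bar> \<le> C * (T - s)" for n \<omega>
  proof -
    have "I n \<omega> = (\<lambda>q. indicator {s..T} q *\<^sub>R I n \<omega> q)"
      using out by (auto simp: fun_eq_iff split: split_indicator)
    then have "(LINT q|lborel. I n \<omega> q) = (LBINT q:{s..T}. I n \<omega> q)"
      unfolding set_lebesgue_integral_def by metis
    moreover have "\<bar>I n \<omega> q\<bar> \<le> C" if "q \<in> {s..T}" for q using IB[of n \<omega> q] that by simp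
    ultimately show ?thesis using set_integral_bound_Icc[OF s(2), of "I n \<omega>" C] by simp
  qed
  have l2: "(\<lambda>n. \<integral>\<omega>. (LINT q|lborel. I n \<omega> q) \<partial>Q)
    \<longlonglongrightarrow> (\<integral>\<omega>. (LINT q|lborel. indicator {s..<T} q * G \<omega> q) \<partial>Q)"
  proof (rule integral_dominated_convergence)
    have mIn: "(\<lambda>\<omega>. LINT q|lborel. I n \<omega> q) \<in> borel_measurable Q" for n
      by (rule lborel.borel_measurable_lebesgue_integral)
        (use mI[of n] in \<open>simp add: case_prod_beta'\<close>)
    show "(\<lambda>\<omega>. LINT q|lborel. I n \<omega> q) \<in> borel_measurable Q" for n by (rule mIn)
    show "(\<lambda>\<omega>. LINT q|lborel. indicator {s..<T} q * G \<omega> q) \<in> borel_measurable Q"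
      by (rule borel_measurable_LIMSEQ_metric[OF mIn lim\<omega>]) (simp add: spQ)
    show "integrable Q (\<lambda>\<omega>. C * (T - s))" by simp
    show "AE \<omega> in Q. (\<lambda>n. LINT q|lborel. I n \<omega> q) \<longlonglongrightarrow> (LINT q|lborel. indicator {s..<T} q * G \<omega> q)"
      using lim\<omega> spQ by (intro AE_I2) simp
    show "AE \<omega> in Q. norm (LINT q|lborel. I n \<omega> q) \<le> C * (T - s)" for n using IiB by simp
  qed
  have "F T - F s - (\<integral>\<omega>. (LINT q|lborel. indicator {s..<T} q * G \<omega> q) \<partial>Q) = 0"
    by (rule LIMSEQ_unique[OF tendsto_diff[OF tendsto_const l2] l1])
  moreover have "F s = \<phi> s i"
  proof -
    have "(LBINT q:{s..s}. k q (\<omega> q)) = 0" for \<omega> :: "real \<Rightarrow> nat"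
      using set_integral_bound_Icc[of s s "\<lambda>q. k q (\<omega> q)" B] kB by simp
    then have Zs: "Z s \<omega> = 1" for \<omega> by (simp add: Z_def)
    have "(\<lambda>\<omega>. \<omega> s) \<in> Q \<rightarrow>\<^sub>M count_space UNIV"
      using measurable_path_sigma_eval[of s "{0..}"] s sQ by (simp cong: measurable_cong_sets)
    then have "(\<lambda>\<omega>. \<phi> s (\<omega> s)) \<in> borel_measurable Q" by (rule measurable_compose) simp
    then have "(\<integral>\<omega>. \<phi> s (\<omega> s) \<partial>Q) = (\<integral>\<omega>. \<phi> s i \<partial>Q)"
      by (rule integral_cong_AE) (use start in \<open>auto elim: eventually_mono\<close>)
    then show ?thesis by (simp add: F_def Zs prob_space)
  qed
  ultimately show ?thesis unfolding integral_indicator_Ico_Icc F_def G_def by simp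
qed

end

section \<open>The HJB equation and verification\<close>

text \<open>Near a point with second coordinate \<open>i\<close>, the function coincides with its
  slice at \<open>i\<close> composed with the first projection. Open singletons are an explicit
  assumption, so that the lemma serves both \<open>nat\<close> and
  \<open>nat discrete\<close>.\<close>

lemma continuous_on_times_discrete:
  fixes f :: "'a::topological_space \<times> 'b::topological_space \<Rightarrow> 'c::topological_space"
  assumes discrete: "\<And>i::'b. open {i}"
  shows "continuous_on (A \<times> UNIV) f \<longleftrightarrow> (\<forall>i. continuous_on A (\<lambda>t. f (t, i)))"
proof (intro iffI allI)
  fix i assume f: "continuous_on (A \<times> UNIV) f"
  show "continuous_on A (\<lambda>t. f (t, i))"
    by (rule continuous_on_compose2[OF f]) (auto intro!: continuous_intros)
next
  assume f: "\<forall>i. continuous_on A (\<lambda>t. f (t, i))"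
  show "continuous_on (A \<times> UNIV) f"
    unfolding continuous_on_def
  proof (intro ballI)
    fix p assume p: "p \<in> A \<times> (UNIV :: 'b set)"
    obtain t i where ti: "p = (t, i)" by (cases p)
    have c: "continuous_on (A \<times> (UNIV :: 'b set)) (\<lambda>p. (\<lambda>t. f (t, i)) (fst p))"
      by (rule continuous_on_compose2[OF f[rule_format, of i]]) (auto intro!: continuous_intros)
    then have "((\<lambda>p. f (fst p, i)) \<longlongrightarrow> f p) (at p within A \<times> UNIV)"
      using p ti by (auto simp: continuous_on_def)
    moreover have "\<forall>\<^sub>F x in at p within A \<times> UNIV. f (fst x, i) = f x"
      unfolding eventually_at_topological
    proof (intro exI conjI ballI impI)
      show "open ((UNIV :: 'a set) \<times> {i})" by (rule open_Times[OF open_UNIV discrete])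
    qed (auto simp: ti)
    ultimately show "(f \<longlongrightarrow> f p) (at p within A \<times> UNIV)" by (rule Lim_transform_eventually)
  qed
qed

locale control_problem = controlled_rates U lam M
  for U :: "nat \<Rightarrow> 'u::metric_space set" and lam :: "nat \<Rightarrow> nat \<Rightarrow> 'u \<Rightarrow> real" and M :: real +
  fixes \<theta> T B :: real and c :: "real \<Rightarrow> nat \<Rightarrow> 'u \<Rightarrow> real" and g :: "nat \<Rightarrow> real"
  assumes T: "0 < T" and theta: "0 < \<theta>"
    and c_nonneg: "\<And>t i v. 0 \<le> t \<Longrightarrow> v \<in> U i \<Longrightarrow> 0 \<le> c t i v"
    and c_le: "\<And>t i v. 0 \<le> t \<Longrightarrow> v \<in> U i \<Longrightarrow> c t i v \<le> B"
    and c_continuous: "\<And>i. continuous_on ({0..} \<times> U i) (\<lambda>(t, v). c t i v)"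
    and g_bounded: "bounded (range g)"
begin

section \<open>Lipschitz and continuity estimates for the Hamiltonian and its infimum\<close>

abbreviation "H \<equiv> hamiltonian lam \<theta> c"

definition hinf :: "(real \<Rightarrow> nat \<Rightarrow> real) \<Rightarrow> real \<Rightarrow> nat \<Rightarrow> real" where
  "hinf \<phi> t i = (INF v\<in>U i. H \<phi> t i v)"

text \<open>Membership in \<open>Cb_space T\<close> with the bound named, since the bound enters the
  estimates.\<close>

definition regular :: "(real \<Rightarrow> nat \<Rightarrow> real) \<Rightarrow> real \<Rightarrow> bool" where
  "regular \<phi> K \<longleftrightarrow> (\<forall>j. continuous_on {0..T} (\<lambda>t. \<phi> t j)) \<and> (\<forall>t\<in>{0..T}. \<forall>j. \<bar>\<phi> t j\<bar> \<le> K)"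

definition mild_solution :: "(real \<Rightarrow> nat \<Rightarrow> real) \<Rightarrow> bool" where
  "mild_solution \<phi> \<longleftrightarrow> (\<exists>K. regular \<phi> K) \<and>
     (\<forall>t\<in>{0..T}. \<forall>i. \<phi> t i = exp (\<theta> * g i) + integral {t..T} (\<lambda>s. hinf \<phi> s i))"

lemma B_nonneg: "0 \<le> B"
proof -
  obtain v where "v \<in> U 0" using U_nonempty by blast
  then show ?thesis using c_nonneg[of 0 v 0] c_le[of 0 v 0] by simp
qed

lemma Lip_nonneg: "0 \<le> \<theta> * B + 2 * M"
  using theta B_nonneg M_nonneg by simp

text \<open>The Lipschitz constant adds the bound \<open>\<theta> * B\<close> of the potential and
  the total mass \<open>2 * M\<close> of a row of rates. Since the Hamiltonian vanishes at \<phi> =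
  0, it also gives the growth bound.\<close>

lemma H_diff:
  assumes "0 \<le> t" "v \<in> U i" "\<And>j. \<bar>\<phi> t j\<bar> \<le> K" "\<And>j. \<bar>\<psi> t j\<bar> \<le> K" "\<And>j. \<bar>\<phi> t j - \<psi> t j\<bar> \<le> d"
  shows "\<bar>H \<phi> t i v - H \<psi> t i v\<bar> \<le> (\<theta> * B + 2 * M) * d"
proof -
  have d: "0 \<le> d" using assms(5)[of 0] by linarith
  have "\<bar>\<theta> * c t i v * \<phi> t i - \<theta> * c t i v * \<psi> t i\<bar> = (\<theta> * c t i v) * \<bar>\<phi> t i - \<psi> t i\<bar>"
    using theta c_nonneg[OF assms(1,2)] by (simp add: right_diff_distrib[symmetric] abs_mult)
  also have "\<dots> \<le> (\<theta> * B) * d"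
    using theta c_nonneg[OF assms(1,2)] c_le[OF assms(1,2)] assms(5)[of i] B_nonneg
      by (intro mult_mono) auto
  finally show ?thesis
    using rate_series_diff_bound[OF assms(2), of "\<phi> t" K "\<psi> t" d] assms unfolding hamiltonian_def
    by (auto simp: distrib_right)
qed

lemma H_bound:
  assumes "0 \<le> t" "v \<in> U i" "\<And>j. \<bar>\<phi> t j\<bar> \<le> K"
  shows "\<bar>H \<phi> t i v\<bar> \<le> (\<theta> * B + 2 * M) * K"
proof -
  have "0 \<le> K" using assms(3)[of 0] by linarith
  then have "\<bar>H \<phi> t i v - H (\<lambda>t j. 0) t i v\<bar> \<le> (\<theta> * B + 2 * M) * K"
    using assms by (intro H_diff[where K=K]) auto
  then show ?thesis by (simp add: hamiltonian_def)
qed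

lemma bdd_below_H:
  assumes "0 \<le> t" "\<And>j. \<bar>\<phi> t j\<bar> \<le> K"
  shows "bdd_below (H \<phi> t i ` U i)"
  using H_bound[of t _ i \<phi> K] assms
  by (intro bdd_belowI[of _ "- ((\<theta> * B + 2 * M) * K)"]) (auto simp: abs_le_iff minus_le_iff)

lemma hinf_le:
  assumes "0 \<le> t" "\<And>j. \<bar>\<phi> t j\<bar> \<le> K" "v \<in> U i"
  shows "hinf \<phi> t i \<le> H \<phi> t i v"
  unfolding hinf_def by (rule cINF_lower[OF bdd_below_H[of t \<phi> K]]) (use assms in auto)

text \<open>An infimum of functions with a common Lipschitz constant keeps that constant; one
  inequality is shown for arbitrary pairs and then used in both orders.\<close>

lemma hinf_diff:
  assumes "0 \<le> t" "\<And>j. \<bar>\<phi> t j\<bar> \<le> K" "\<And>j. \<bar>\<psi> t j\<bar> \<le> K" "\<And>j. \<bar>\<phi> t j - \<psi> t j\<bar> \<le> d"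
  shows "\<bar>hinf \<phi> t i - hinf \<psi> t i\<bar> \<le> (\<theta> * B + 2 * M) * d"
proof -
  let ?L = "(\<theta> * B + 2 * M) * d"
  have one: "hinf \<phi> t i - ?L \<le> hinf \<psi> t i"
    if "\<And>j. \<bar>\<phi> t j\<bar> \<le> K" "\<And>j. \<bar>\<psi> t j\<bar> \<le> K" "\<And>j. \<bar>\<phi> t j - \<psi> t j\<bar> \<le> d" for \<phi> \<psi>
    unfolding hinf_def[of \<psi>]
  proof (rule cINF_greatest[OF U_nonempty])
    fix v assume v: "v \<in> U i"
    show "hinf \<phi> t i - ?L \<le> H \<psi> t i v"
    proof -
      have "hinf \<phi> t i \<le> H \<phi> t i v" using assms(1) that(1) v by (rule hinf_le)
      moreover have "\<bar>H \<phi> t i v - H \<psi> t i v\<bar> \<le> ?L" using assms(1) v that by (rule H_diff)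
      ultimately show ?thesis by linarith
    qed
  qed
  show ?thesis
    using one[of \<phi> \<psi>] one[of \<psi> \<phi>] assms by (simp add: abs_minus_commute abs_le_iff)
qed

lemma hinf_bound:
  assumes "0 \<le> t" "\<And>j. \<bar>\<phi> t j\<bar> \<le> K"
  shows "\<bar>hinf \<phi> t i\<bar> \<le> (\<theta> * B + 2 * M) * K"
proof -
  have "0 \<le> K" using assms(2)[of 0] by linarith
  then have "\<bar>hinf \<phi> t i - hinf (\<lambda>t j. 0) t i\<bar> \<le> (\<theta> * B + 2 * M) * K"
    using assms by (intro hinf_diff[where K=K]) auto
  then show ?thesis using U_nonempty by (simp add: hinf_def hamiltonian_def)
qed

lemma H_continuous:
  assumes "regular \<phi> K"
  shows "continuous_on ({0..T} \<times> U i) (\<lambda>(t, v). H \<phi> t i v)"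
proof -
  have \<phi>: "\<And>j. continuous_on {0..T} (\<lambda>t. \<phi> t j)" "\<And>t j. t \<in> {0..T} \<Longrightarrow> \<bar>\<phi> t j\<bar> \<le> K"
    using assms by (auto simp: regular_def)
  have "continuous_on ({0..T} \<times> U i) (\<lambda>p. \<phi> (fst p) i)"
    by (rule continuous_on_compose2[OF \<phi>(1)]) (auto intro!: continuous_intros)
  moreover have "continuous_on ({0..T} \<times> U i) (\<lambda>p. c (fst p) i (snd p))"
  proof -
    have "{0..T} \<times> U i \<subseteq> {0..} \<times> U i" by auto
    from continuous_on_subset[OF c_continuous this] show ?thesis by (simp add: case_prod_beta')
  qed
  ultimately show ?thesis
    using rate_series_continuous[of "{0..T}" \<phi> K i] \<phi>
    by (auto simp: hamiltonian_def case_prod_beta' intro!: continuous_intros)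
qed

lemma hinf_continuous:
  assumes "regular \<phi> K"
  shows "continuous_on {0..T} (\<lambda>t. hinf \<phi> t i)"
  unfolding hinf_def
  by (rule continuous_on_INF_compact[OF compact_Icc U_compact U_nonempty H_continuous[OF assms]])

lemma regular_cong:
  assumes "\<And>t i. t \<in> {0..T} \<Longrightarrow> \<phi> t i = \<psi> t i"
  shows "regular \<phi> K \<longleftrightarrow> regular \<psi> K"
  unfolding regular_def using assms by (intro conj_cong all_cong1 continuous_on_cong ball_cong) auto

lemma hinf_cong:
  assumes "\<And>j. \<phi> t j = \<psi> t j"
  shows "hinf \<phi> t i = hinf \<psi> t i"
  unfolding hinf_def hamiltonian_def by (simp add: assms)

text \<open>Lets the property pass to the value function, which is identified with a solution only
  on \<open>{0..T}\<close>.\<close>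

lemma mild_solution_cong:
  assumes eq: "\<And>t i. t \<in> {0..T} \<Longrightarrow> \<phi> t i = \<psi> t i" and \<phi>: "mild_solution \<phi>"
  shows "mild_solution \<psi>"
proof -
  have "integral {t..T} (\<lambda>s. hinf \<phi> s i) = integral {t..T} (\<lambda>s. hinf \<psi> s i)" if "t \<in> {0..T}" for t i
    using that eq by (intro Henstock_Kurzweil_Integration.integral_cong hinf_cong) auto
  moreover have "regular \<phi> K \<longleftrightarrow> regular \<psi> K" for K by (rule regular_cong) (rule eq)
  ultimately show ?thesis using \<phi> eq unfolding mild_solution_def by fastforce
qed

lemma Cb_space_iff_regular: "\<phi> \<in> Cb_space T \<longleftrightarrow> (\<exists>K. regular \<phi> K)"
proof -
  have "bounded ((\<lambda>(t, i). \<phi> t i) ` ({0..T} \<times> UNIV)) \<longleftrightarrow> (\<exists>K. \<forall>t\<in>{0..T}. \<forall>j. \<bar>\<phi> t j\<bar> \<le> K)"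
    by (auto simp: bounded_iff)
  then show ?thesis
    using continuous_on_times_discrete[of "{0..T}" "\<lambda>(t, i). \<phi> t i", OF
      discrete_topology_class.open_discrete]
    by (auto simp: Cb_space_def regular_def)
qed

section \<open>Equivalence of the differential and the integral form of the equation\<close>

lemma mild_solution_increment:
  assumes \<phi>: "mild_solution \<phi>" and ab: "0 \<le> a" "a \<le> b" "b \<le> T"
  shows "\<phi> b i - \<phi> a i = - integral {a..b} (\<lambda>s. hinf \<phi> s i)"
proof -
  obtain K where K: "regular \<phi> K" using \<phi> by (auto simp: mild_solution_def)
  have "(\<lambda>s. hinf \<phi> s i) integrable_on {a..T}"
    using ab by (intro integrable_continuous_real continuous_on_subset[OF hinf_continuous[OF K]])
      auto
  then have "integral {a..b} (\<lambda>s. hinf \<phi> s i) + integral {b..T} (\<lambda>s. hinf \<phi> s i)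
    = integral {a..T} (\<lambda>s. hinf \<phi> s i)"
    using ab by (intro Henstock_Kurzweil_Integration.integral_combine) auto
  moreover have "\<phi> t i = exp (\<theta> * g i) + integral {t..T} (\<lambda>s. hinf \<phi> s i)" if "t \<in> {0..T}" for t
    using \<phi> that unfolding mild_solution_def by blast
  ultimately show ?thesis using ab by simp
qed

text \<open>The filter contains a right neighbourhood even at \<open>t = 0\<close>; this is what
  makes \<open>vector_derivative\<close> unique there.\<close>

lemma at_within_Ico_not_bot:
  assumes "t \<in> {0..<T}"
  shows "at t within {0..<T} \<noteq> bot"
proof -
  have "at_right t = at t within {t..(t + T) / 2}" using assms
    by (intro at_within_Icc_at_right[symmetric]) auto
  also have "\<dots> \<le> at t within {0..<T}" using assms by (intro at_le) auto
  finally have "at_right t \<le> at t within {0..<T}" .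
  then show ?thesis using le_bot[of "at_right t"] trivial_limit_at_right_real[of t]
    by (intro notI) simp
qed

lemma HJB_solution_iff_mild: "HJB_solution U lam \<theta> c g T \<phi> \<longleftrightarrow> mild_solution \<phi>"
proof
  assume \<phi>: "HJB_solution U lam \<theta> c g T \<phi>"
  then obtain K where K: "regular \<phi> K" using Cb_space_iff_regular[of \<phi>]
    by (auto simp: HJB_solution_def)
  have "\<phi> t i = exp (\<theta> * g i) + integral {t..T} (\<lambda>s. hinf \<phi> s i)" if t: "t \<in> {0..T}" for t i
  proof -
    obtain D where D: "\<And>t. t \<in> {0..<T} \<Longrightarrow> ((\<lambda>s. \<phi> s i) has_vector_derivative D t) (at t within
      {0..<T})"
      using \<phi> unfolding HJB_solution_def C1_space_def by blast
    have Dh: "D x = - hinf \<phi> x i" if x: "x \<in> {0..<T}" for x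
      using \<phi> x vector_derivative_within[OF at_within_Ico_not_bot[OF x] D[OF x]]
      unfolding HJB_solution_def hinf_def by (metis add_eq_0_iff2)
    \<comment> \<open>The equation holds only before \<open>T\<close>; continuity of \<phi> up to
      \<open>T\<close> replaces the missing derivative at the end point.\<close>
    have "((\<lambda>s. - hinf \<phi> s i) has_integral (\<phi> T i - \<phi> t i)) {t..T}"
    proof (rule fundamental_theorem_of_calculus_interior)
      have "continuous_on {0..T} (\<lambda>s. \<phi> s i)" using K by (simp add: regular_def)
      then show "continuous_on {t..T} (\<lambda>s. \<phi> s i)" by (rule continuous_on_subset) (use t in auto)
      fix x assume x: "x \<in> {t<..<T}"
      then have "at x within {0..<T} = at x" using t
        by (intro at_within_open_subset[of x "{0<..<T}"]) auto
      then show "((\<lambda>s. \<phi> s i) has_vector_derivative - hinf \<phi> x i) (at x)" using D[of x] Dh[of x] x t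
        by auto
    qed (use t in auto)
    then have "integral {t..T} (\<lambda>s. - hinf \<phi> s i) = \<phi> T i - \<phi> t i" by (rule integral_unique)
    moreover have "\<phi> T i = exp (\<theta> * g i)" using \<phi> by (auto simp: HJB_solution_def)
    ultimately show ?thesis by simp
  qed
  then show "mild_solution \<phi>" using K by (auto simp: mild_solution_def)
next
  assume \<phi>: "mild_solution \<phi>"
  then obtain K where K: "regular \<phi> K" by (auto simp: mild_solution_def)
  have der: "((\<lambda>s. \<phi> s i) has_vector_derivative - hinf \<phi> t i) (at t within {0..<T})"
    if t: "t \<in> {0..<T}" for t i
  proof -
    \<comment> \<open>The integral is taken from 0, so that the variable of differentiation is the
      upper limit.\<close>
    have "((\<lambda>u. integral {0..u} (\<lambda>s. hinf \<phi> s i)) has_vector_derivative hinf \<phi> t i) (at t within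
      {0..T})"
      using t by (intro integral_has_vector_derivative hinf_continuous[OF K]) auto
    then have "((\<lambda>u. integral {0..u} (\<lambda>s. hinf \<phi> s i)) has_vector_derivative hinf \<phi> t i) (at t
      within {0..<T})"
      by (rule has_vector_derivative_within_subset) auto
    then have "((\<lambda>u. \<phi> 0 i - integral {0..u} (\<lambda>s. hinf \<phi> s i)) has_vector_derivative (0
      - hinf \<phi> t i)) (at t within {0..<T})"
      by (intro has_vector_derivative_diff has_vector_derivative_const)
    then have "((\<lambda>s. \<phi> s i) has_vector_derivative (0 - hinf \<phi> t i)) (at t within {0..<T})"
    proof (rule has_vector_derivative_transform[OF t, rotated])
      show "\<phi> s i = \<phi> 0 i - integral {0..s} (\<lambda>s. hinf \<phi> s i)" if "s \<in> {0..<T}" for s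
        using mild_solution_increment[OF \<phi>, of 0 s i] that by simp
    qed
    then show ?thesis by simp
  qed
  have "\<phi> \<in> C1_space T"
    unfolding C1_space_def
  proof (intro CollectI allI exI conjI ballI)
    fix i
    show "continuous_on {0..<T} (\<lambda>t. - hinf \<phi> t i)"
      by (intro continuous_on_minus continuous_on_subset[OF hinf_continuous[OF K]]) auto
  qed (rule der)
  moreover have "vector_derivative (\<lambda>s. \<phi> s i) (at t within {0..<T}) + (INF v\<in>U i. H \<phi> t i v) = 0"
    if t: "t \<in> {0..<T}" for t i
    using vector_derivative_within[OF at_within_Ico_not_bot[OF t] der[OF t]] by (simp add: hinf_def)
  moreover have "\<phi> T i = exp (\<theta> * g i)" for i
  proof -
    have "\<phi> T i = exp (\<theta> * g i) + integral {T..T} (\<lambda>s. hinf \<phi> s i)"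
      using \<phi> T unfolding mild_solution_def by auto
    then show ?thesis by simp
  qed
  ultimately show "HJB_solution U lam \<theta> c g T \<phi>"
    using K Cb_space_iff_regular[of \<phi>] by (auto simp: HJB_solution_def)
qed

section \<open>Existence of a solution of the integral equation\<close>

lemma terminal_bounded:
  obtains G where "\<And>i. \<bar>exp (\<theta> * g i)\<bar> \<le> G"
proof -
  obtain b where b: "\<And>i. \<bar>g i\<bar> \<le> b" using g_bounded by (auto simp: bounded_iff)
  have "\<theta> * g i \<le> \<theta> * b" for i using b[of i] theta by (intro mult_left_mono) auto
  then show thesis by (intro that[of "exp (\<theta> * b)"]) simp
qed

text \<open>
  The weight \<open>exp (2 L (T - t))\<close> turns the Picard map into a contraction on all of \<open>[0,T]\<close>. The
  state space enters as \<^typ>\<open>nat discrete\<close> because \<^typ>\<open>nat\<close> is not an instance of the class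
  \<^class>\<open>metric_space\<close>, which completeness of the space of bounded continuous functions requires.
\<close>

lemma mild_solution_exists: "\<exists>\<phi>. mild_solution \<phi>"
proof -
  \<comment> \<open>The added 1 keeps \<open>L\<close> positive even if the Lipschitz constant is 0,
    as \<open>2 * L\<close> becomes a divisor.\<close>
  define L where "L = \<theta> * B + 2 * M + 1"
  have L: "0 < L" "\<theta> * B + 2 * M \<le> L" using Lip_nonneg by (auto simp: L_def)
  define E where "E t = exp (2 * L * (T - t))" for t
  \<comment> \<open>Clamping extends functions on \<open>{0..T}\<close> to the whole line, on which
    the bounded continuous functions live.\<close>
  define \<tau> where "\<tau> t = max 0 (min T t)" for t
  have \<tau>: "\<tau> t \<in> {0..T}" "t \<in> {0..T} \<Longrightarrow> \<tau> t = t" for t using T by (auto simp: \<tau>_def)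
  have E0: "0 < E t" for t by (simp add: E_def)
  have EE: "E t \<le> E 0" if "t \<in> {0..T}" for t using that L by (simp add: E_def)
  \<comment> \<open>The fixed point \<psi> is sought as the solution divided by the weight;
    \<open>W\<close> multiplies the weight back, so the plain supremum norm of \<psi> is the
    weighted norm of \<open>W \<psi>\<close>.\<close>
  define W where "W \<psi> t i = E t * apply_bcontfun \<psi> (t, discrete i)"
    for \<psi> :: "(real \<times> nat discrete) \<Rightarrow>\<^sub>C real" and t i
  have WB: "\<bar>W \<psi> t i\<bar> \<le> E t * norm \<psi>" for \<psi> t i
    using norm_bounded[of \<psi> "(t, discrete i)"] E0[of t] by (simp add: W_def abs_mult)
  have Wreg: "regular (W \<psi>) (E 0 * norm \<psi>)" for \<psi>
    unfolding regular_def
  proof (intro conjI allI ballI)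
    fix j
    have "continuous_on {0..T} (\<lambda>t. apply_bcontfun \<psi> (t, discrete j))"
      by (intro continuous_on_compose2[OF continuous_on_apply_bcontfun] continuous_intros) auto
    then show "continuous_on {0..T} (\<lambda>t. W \<psi> t j)" unfolding W_def E_def
      by (intro continuous_intros)
  next
    fix t j assume "t \<in> {0..T}"
    then show "\<bar>W \<psi> t j\<bar> \<le> E 0 * norm \<psi>"
      using WB[of \<psi> t j] mult_right_mono[OF EE[of t], of "norm \<psi>"] by simp
  qed
  have hi: "(\<lambda>s. hinf (W \<psi>) s i) integrable_on {t..T}" if "t \<in> {0..T}" for \<psi> t i
    using that by (intro integrable_continuous_real continuous_on_subset[OF hinf_continuous[OF
      Wreg]]) auto
  define F where "F \<psi> p = (exp (\<theta> * g (of_discrete (snd p))) +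
      integral {\<tau> (fst p)..T} (\<lambda>s. hinf (W \<psi>) s (of_discrete (snd p)))) / E (\<tau> (fst p))" for \<psi> p
  obtain G where G: "\<And>i. \<bar>exp (\<theta> * g i)\<bar> \<le> G" using terminal_bounded by blast
  have Fb: "F \<psi> \<in> bcontfun" for \<psi>
  proof (rule bcontfun_normI)
    have "continuous_on UNIV (\<lambda>t. F \<psi> (t, i'))" for i'
    proof -
      let ?i = "of_discrete i'"
      have "continuous_on {0..T} (\<lambda>t. integral {t..T} (\<lambda>s. hinf (W \<psi>) s ?i))"
        using T by (intro indefinite_integral_continuous_1' hi) auto
      then have "continuous_on UNIV (\<lambda>t. integral {\<tau> t..T} (\<lambda>s. hinf (W \<psi>) s ?i))"
        by (rule continuous_on_compose2) (use \<tau> in \<open>auto simp: \<tau>_def intro!: continuous_intros\<close>)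
      then show ?thesis unfolding F_def E_def \<tau>_def by (auto intro!: continuous_intros)
    qed
    then show "continuous_on UNIV (F \<psi>)"
      using continuous_on_times_discrete[of UNIV "F \<psi>", OF open_discrete]
        by (auto simp: F_def)
    fix p :: "real \<times> nat discrete"
    let ?i = "of_discrete (snd p)"
    let ?C = "(\<theta> * B + 2 * M) * (E 0 * norm \<psi>)"
    have "norm (integral {\<tau> (fst p)..T} (\<lambda>s. hinf (W \<psi>) s ?i)) \<le> ?C * (T - \<tau> (fst p))"
    proof (rule integral_bound)
      show "continuous_on {\<tau> (fst p)..T} (\<lambda>s. hinf (W \<psi>) s ?i)"
        using \<tau>(1)[of "fst p"] by (intro continuous_on_subset[OF hinf_continuous[OF Wreg]]) auto
      fix s assume "s \<in> {\<tau> (fst p)..T}"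
      then have "s \<in> {0..T}" using \<tau>(1)[of "fst p"] by auto
      then show "norm (hinf (W \<psi>) s ?i) \<le> ?C"
        using hinf_bound[of s "W \<psi>" "E 0 * norm \<psi>" "?i"] Wreg[of \<psi>] by (auto simp: regular_def)
    qed (use \<tau>(1)[of "fst p"] in auto)
    also have "\<dots> \<le> ?C * T" using \<tau>(1)[of "fst p"] Lip_nonneg E0[of 0] by (intro mult_left_mono) auto
    finally have "\<bar>exp (\<theta> * g ?i) + integral {\<tau> (fst p)..T} (\<lambda>s. hinf (W \<psi>) s ?i)\<bar> \<le> G + ?C * T"
      by (intro order_trans[OF abs_triangle_ineq] add_mono G) simp
    moreover have "1 \<le> E (\<tau> (fst p))" using \<tau>(1)[of "fst p"] L by (simp add: E_def)
    ultimately have "\<bar>exp (\<theta> * g ?i) + integral {\<tau> (fst p)..T} (\<lambda>s. hinf (W \<psi>) s ?i)\<bar> / \<bar>E (\<tau> (fst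
      p))\<bar>
        \<le> (G + ?C * T) / 1"
      by (intro frac_le) auto
    then show "norm (F \<psi> p) \<le> G + ?C * T"
      unfolding F_def real_norm_def abs_divide by simp
  qed
  define \<Phi> where "\<Phi> \<psi> = Bcontfun (F \<psi>)" for \<psi>
  have \<Phi>: "apply_bcontfun (\<Phi> \<psi>) = F \<psi>" for \<psi> unfolding \<Phi>_def by (rule Bcontfun_inverse[OF Fb])
  \<comment> \<open>Integrating the weight produces the factor \<open>1 / (2 * L)\<close>, which
    against the Lipschitz constant \<open>L\<close> leaves the contraction constant
    \<open>1 / 2\<close>.\<close>
  have Eint: "(E has_integral (E t - 1) / (2 * L)) {t..T}" if "t \<in> {0..T}" for t
  proof -
    have "(E has_integral (- E T / (2 * L) - (- E t / (2 * L)))) {t..T}"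
    proof (rule fundamental_theorem_of_calculus)
      show "((\<lambda>s. - E s / (2 * L)) has_vector_derivative E x) (at x within {t..T})" for x
        unfolding E_def has_real_derivative_iff_has_vector_derivative[symmetric]
        using L(1) by (auto intro!: derivative_eq_intros)
    qed (use that in auto)
    then show ?thesis by (simp add: E_def diff_divide_distrib)
  qed
  have "dist (\<Phi> \<psi>) (\<Phi> \<eta>) \<le> 1 / 2 * dist \<psi> \<eta>" for \<psi> \<eta>
  proof (rule dist_bound)
    fix p :: "real \<times> nat discrete"
    obtain t0 i' where p: "p = (t0, i')" by (cases p)
    define i where "i = of_discrete i'"
    define t where "t = \<tau> t0"
    have t: "t \<in> {0..T}" unfolding t_def by (rule \<tau>)
    let ?d = "dist \<psi> \<eta>"
    have "norm (integral {t..T} (\<lambda>s. hinf (W \<psi>) s i - hinf (W \<eta>) s i))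
      \<le> integral {t..T} (\<lambda>s. (L * ?d) * E s)"
    proof (rule Henstock_Kurzweil_Integration.integral_norm_bound_integral)
      show "(\<lambda>s. hinf (W \<psi>) s i - hinf (W \<eta>) s i) integrable_on {t..T}"
        by (intro Henstock_Kurzweil_Integration.integrable_diff hi t)
      show "(\<lambda>s. L * ?d * E s) integrable_on {t..T}"
        using Eint[OF t] by (intro integrable_on_mult_right) (auto simp: integrable_on_def)
      fix s assume "s \<in> {t..T}"
      then have s: "s \<in> {0..T}" using t by auto
      have "\<bar>hinf (W \<psi>) s i - hinf (W \<eta>) s i\<bar> \<le> (\<theta> * B + 2 * M) * (E s * ?d)"
      proof (rule hinf_diff)
        show "\<bar>W \<psi> s j\<bar> \<le> E s * max (norm \<psi>) (norm \<eta>)" "\<bar>W \<eta> s j\<bar> \<le> E s * max (norm \<psi>) (norm \<eta>)"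
          for j
          using E0[of s] by (auto intro!: order_trans[OF WB] mult_left_mono)
        show "\<bar>W \<psi> s j - W \<eta> s j\<bar> \<le> E s * ?d" for j
          using dist_bounded[of \<psi> "(s, discrete j)" \<eta>] E0[of s]
            by (simp add: W_def right_diff_distrib[symmetric] abs_mult dist_real_def)
      qed (use s in auto)
      also have "\<dots> \<le> L * (E s * ?d)" using L E0[of s] by (intro mult_right_mono) auto
      finally show "norm (hinf (W \<psi>) s i - hinf (W \<eta>) s i) \<le> L * ?d * E s" by (simp add: ac_simps)
    qed
    also have "\<dots> = L * ?d * ((E t - 1) / (2 * L))"
      using Eint[OF t] by (simp add: integral_unique)
    also have "\<dots> \<le> 1 / 2 * ?d * E t" using L by (simp add: field_simps)
    finally have "\<bar>integral {t..T} (\<lambda>s. hinf (W \<psi>) s i) - integral {t..T} (\<lambda>s. hinf (W \<eta>) s i)\<bar>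
      \<le> 1 / 2 * ?d * E t"
      using hi[OF t] by (simp add: Henstock_Kurzweil_Integration.integral_diff)
    then have "\<bar>integral {t..T} (\<lambda>s. hinf (W \<psi>) s i) - integral {t..T} (\<lambda>s. hinf (W \<eta>) s i)\<bar> / E t
      \<le> 1 / 2 * ?d"
      using E0[of t] by (subst pos_divide_le_eq) auto
    moreover have "F \<psi> p - F \<eta> p = (integral {t..T} (\<lambda>s. hinf (W \<psi>) s i)
      - integral {t..T} (\<lambda>s. hinf (W \<eta>) s i)) / E t"
      unfolding F_def p t_def i_def by (simp add: diff_divide_distrib add_divide_distrib)
    ultimately show "dist (apply_bcontfun (\<Phi> \<psi>) p) (apply_bcontfun (\<Phi> \<eta>) p) \<le> 1 / 2 * ?d"
      using E0[of t] unfolding \<Phi> dist_real_def by (simp add: abs_divide)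
  qed
  then obtain \<psi> where fp: "\<Phi> \<psi> = \<psi>" using banach_fix_type[of "1 / 2" \<Phi>] by auto
  have "W \<psi> t i = exp (\<theta> * g i) + integral {t..T} (\<lambda>s. hinf (W \<psi>) s i)" if t: "t \<in> {0..T}" for t i
  proof -
    have "W \<psi> t i = E t * F \<psi> (t, discrete i)" unfolding W_def using \<Phi>[of \<psi>] fp by simp
    then show ?thesis using E0[of t] \<tau>(2)[OF t] by (simp add: F_def discrete_inverse)
  qed
  then show ?thesis using Wreg unfolding mild_solution_def by (intro exI[of _ "W \<psi>"]) blast
qed

section \<open>Minimizing selectors, verification and the value function\<close>

lemma minimizing_selector_exists:
  assumes "regular \<phi> K"
  shows "\<exists>u\<in>markov_controls U. minimizing_selector U lam \<theta> c T \<phi> u"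
proof -
  have "\<exists>w. w \<in> restrict_space borel {0..T} \<rightarrow>\<^sub>M restrict_space borel (U i)
    \<and> (\<forall>t\<in>{0..T}. H \<phi> t i (w t) = hinf \<phi> t i)" for i
    using measurable_argmin_selection[OF compact_Icc U_compact U_nonempty H_continuous[OF assms]]
    unfolding hinf_def by metis
  then obtain w where w: "\<And>i. w i \<in> restrict_space borel {0..T} \<rightarrow>\<^sub>M restrict_space borel (U i)"
    "\<And>i t. t \<in> {0..T} \<Longrightarrow> H \<phi> t i (w i t) = hinf \<phi> t i" by metis
  \<comment> \<open>Selection over the compact interval \<open>{0..T}\<close> is extended past
    \<open>T\<close> by its value at \<open>T\<close>, as a Markov control must be defined at all
    nonnegative times.\<close>
  have "(\<lambda>t. min T t) \<in> restrict_space borel {0..} \<rightarrow>\<^sub>M restrict_space borel {0..T}"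
    using T by (intro measurable_restrict_space3) auto
  then have "(\<lambda>t. w i (min T t)) \<in> restrict_space borel {0..} \<rightarrow>\<^sub>M restrict_space borel (U i)" for i
    using measurable_compose[OF _ w(1)] by blast
  then have "(\<lambda>t i. w i (min T t)) \<in> markov_controls U" by (auto simp: markov_controls_def)
  moreover have "minimizing_selector U lam \<theta> c T \<phi> (\<lambda>t i. w i (min T t))"
    using w(2) unfolding minimizing_selector_def hinf_def by auto
  ultimately show ?thesis by blast
qed

lemma cost_measurable:
  assumes "u \<in> markov_controls U"
  shows "(\<lambda>t. indicator {0..} t * (\<theta> * c t i (u t i))) \<in> borel_measurable borel"
proof -
  have "(\<lambda>t. c t i (u t i)) \<in> borel_measurable (restrict_space borel {0..})"
    using assms by (intro measurable_Caratheodory[OF c_continuous]) (auto simp: markov_controls_def)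
  then have "(\<lambda>t. \<theta> * c t i (u t i)) \<in> borel_measurable (restrict_space borel {0..})" by measurable
  then show ?thesis
    using borel_measurable_restrict_space_iff[of "{0::real..}" borel "\<lambda>t. \<theta> * c t i (u t i)"]
      by simp
qed

text \<open>With \<open>D\<close> minus the infimum of the Hamiltonian and \<open>k\<close> the
  running cost times \<theta>, the Feynman-Kac integrand is the positive factor \<open>Z\<close>
  times the excess of the Hamiltonian over its infimum.\<close>

lemma verification:
  assumes \<phi>: "mild_solution \<phi>" and u: "u \<in> markov_controls U" and s: "s \<in> {0..T}"
    and P: "solves_martingale_problem lam u s i (P u s i)"
  shows "\<phi> s i \<le> cost_J P \<theta> c g T u s i"
    and "minimizing_selector U lam \<theta> c T \<phi> u \<Longrightarrow> cost_J P \<theta> c g T u s i = \<phi> s i"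
proof -
  let ?Q = "P u s i"
  obtain K where K: "regular \<phi> K" using \<phi> by (auto simp: mild_solution_def)
  have \<phi>K: "\<bar>\<phi> t j\<bar> \<le> K" if "t \<in> {0..T}" for t j using K that by (auto simp: regular_def)
  have spQ: "space ?Q = paths"
    using P sets_eq_imp_space_eq[of ?Q "path_sigma {0..}"]
      by (auto simp: solves_martingale_problem_def)
  define k where "k q j = indicator {0..} q * (\<theta> * c q j (u q j))" for q j
  define D where "D q j = indicator {0..T} q *\<^sub>R - hinf \<phi> q j" for q j
  \<comment> \<open>Nothing is known of \<phi> outside \<open>{0..T}\<close>; the constant extension
    has the global bound that \<open>feynman_kac\<close> asks for.\<close>
  define \<phi>' where "\<phi>' q j = \<phi> (max 0 (min T q)) j" for q j
  have \<phi>': "\<phi>' q = \<phi> q" if "q \<in> {0..T}" for q using that by (auto simp: \<phi>'_def)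
  have kB: "\<bar>k q j\<bar> \<le> \<theta> * B" for q j
    using theta c_nonneg[of q "u q j" j] c_le[of q "u q j" j] markov_control_in[OF u, of q j]
      B_nonneg
    by (auto simp: k_def abs_mult split: split_indicator)
  have Dm: "(\<lambda>q. D q j) \<in> borel_measurable borel" for j
    unfolding D_def by (intro borel_measurable_continuous_on_indicator continuous_on_minus
      hinf_continuous[OF K]) auto
  have L0: "0 \<le> (\<theta> * B + 2 * M) * K" using Lip_nonneg \<phi>K[OF s, of 0]
    by (intro mult_nonneg_nonneg) linarith+
  have DL: "\<bar>D q j\<bar> \<le> (\<theta> * B + 2 * M) * K" for q j
    using hinf_bound[of q \<phi> K j] \<phi>K[of q] L0 by (auto simp: D_def split: split_indicator)
  have \<phi>'K: "\<bar>\<phi>' q j\<bar> \<le> K" for q j unfolding \<phi>'_def using T by (intro \<phi>K) auto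
  have inc: "\<phi>' b j - \<phi>' a j = (LBINT q:{a..b}. D q j)" if ab: "s \<le> a" "a \<le> b" "b \<le> T" for a b j
  proof -
    have ab': "0 \<le> a" using ab s by auto
    have "set_integrable lborel {a..b} (\<lambda>q. D q j)"
      by (rule set_integrable_bounded_Icc[OF _ DL]) (use Dm in \<open>simp add: set_borel_measurable_def\<close>)
    then have "(LBINT q:{a..b}. D q j) = integral {a..b} (\<lambda>q. D q j)"
      by (rule set_borel_integral_eq_integral)
    also have "\<dots> = integral {a..b} (\<lambda>q. - hinf \<phi> q j)"
      using ab ab' by (intro Henstock_Kurzweil_Integration.integral_cong) (auto simp: D_def)
    also have "\<dots> = \<phi> b j - \<phi> a j" using mild_solution_increment[OF \<phi> ab' ab(2,3)] by simp
    finally show ?thesis using \<phi>'[of a] \<phi>'[of b] ab ab' by simp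
  qed
  let ?Z = "\<lambda>t \<omega>. exp (LBINT q:{s..t}. k q (\<omega> q))"
  let ?I = "\<lambda>\<omega> q. ?Z q \<omega> * (k q (\<omega> q) * \<phi>' q (\<omega> q) + D q (\<omega> q) + generator lam u q (\<phi>' q) (\<omega> q))"
  have FK: "(\<integral>\<omega>. ?Z T \<omega> * \<phi>' T (\<omega> T) \<partial>?Q) = \<phi>' s i + (\<integral>\<omega>. (LBINT q:{s..T}. ?I \<omega> q) \<partial>?Q)"
    by (rule feynman_kac[OF u _ _ P _ kB Dm DL \<phi>'K inc])
      (use s cost_measurable[OF u] in \<open>auto simp: k_def\<close>)
  \<comment> \<open>Only the action in the cost depends on the left limit, so
    \<open>path_left_limit_integral\<close> is applied with the state argument of \<open>c\<close>
    held at the current state.\<close>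
  have "?Z T \<omega> * \<phi>' T (\<omega> T) = exp (\<theta> * ((LBINT q:{s..T}. c q (\<omega> q) (control_process u q \<omega>))
    + g (\<omega> T)))" if \<omega>: "\<omega> \<in> paths" for \<omega>
  proof -
    have "(LBINT q:{s..T}. k q (\<omega> q)) = (LBINT q:{s..T}. \<theta> * c q (\<omega> q) (u q (\<omega> q)))"
      using s by (intro set_lebesgue_integral_cong) (auto simp: k_def)
    also have "\<dots> = \<theta> * (LBINT q:{s..T}. c q (\<omega> q) (u q (\<omega> q)))" by simp
    also have "(LBINT q:{s..T}. c q (\<omega> q) (u q (\<omega> q)))
      = (LBINT q:{s..T}. c q (\<omega> q) (control_process u q \<omega>))"
      unfolding control_process_def using path_left_limit_integral[OF \<omega>, of s,
        where f="\<lambda>q a. c q (\<omega> q) (u q a)" and t=T] s by simp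
    moreover have "\<phi>' T j = exp (\<theta> * g j)" for j
      using \<phi> \<phi>'[of T] T by (auto simp: mild_solution_def)
    ultimately show ?thesis by (simp add: exp_add distrib_left)
  qed
  then have "cost_J P \<theta> c g T u s i = (\<integral>\<omega>. ?Z T \<omega> * \<phi>' T (\<omega> T) \<partial>?Q)"
    unfolding cost_J_def using spQ by (intro Bochner_Integration.integral_cong) auto
  then have cost: "cost_J P \<theta> c g T u s i = \<phi> s i + (\<integral>\<omega>. (LBINT q:{s..T}. ?I \<omega> q) \<partial>?Q)"
    unfolding FK \<phi>'[OF s] .
  have I: "?I \<omega> q = ?Z q \<omega> * (H \<phi> q (\<omega> q) (u q (\<omega> q)) - hinf \<phi> q (\<omega> q))" if "q \<in> {s..T}" for \<omega> q
    using that s \<phi>'[of q] by (simp add: k_def D_def hamiltonian_def generator_def)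
  have nonneg: "0 \<le> (LBINT q:{s..T}. f q)" if "\<And>q. q \<in> {s..T} \<Longrightarrow> 0 \<le> f q" for f :: "real \<Rightarrow> real"
    unfolding set_lebesgue_integral_def using that
    by (intro Bochner_Integration.integral_nonneg) (auto split: split_indicator)
  have "0 \<le> (\<integral>\<omega>. (LBINT q:{s..T}. ?I \<omega> q) \<partial>?Q)"
  proof (intro Bochner_Integration.integral_nonneg nonneg)
    fix \<omega> q assume q: "q \<in> {s..T}"
    then have "hinf \<phi> q (\<omega> q) \<le> H \<phi> q (\<omega> q) (u q (\<omega> q))"
      using s \<phi>K by (intro hinf_le[where K=K] markov_control_in[OF u]) auto
    then show "0 \<le> ?I \<omega> q" unfolding I[OF q] by simp
  qed
  then show "\<phi> s i \<le> cost_J P \<theta> c g T u s i" using cost by simp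
  assume sel: "minimizing_selector U lam \<theta> c T \<phi> u"
  \<comment> \<open>A selector is minimizing only before \<open>T\<close>; the time \<open>T\<close>
    itself is discarded as a null set.\<close>
  have "(LBINT q:{s..T}. ?I \<omega> q) = 0" for \<omega>
  proof -
    have "indicator {s..<T} q * ?I \<omega> q = 0" for q
      using I[of q \<omega>] sel s by (auto simp: minimizing_selector_def hinf_def split: split_indicator)
    then have "(LINT q|lborel. indicator {s..<T} q * ?I \<omega> q) = 0"
      by (simp only: Bochner_Integration.integral_zero)
    then show ?thesis by (simp only: integral_indicator_Ico_Icc)
  qed
  then show "cost_J P \<theta> c g T u s i = \<phi> s i" using cost by simp
qed

text \<open>The solution bounds every cost from below and equals the cost of a minimizing selector,
  so the infimum is attained. As this holds for every solution, it also contains uniqueness.\<close>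

lemma mild_solution_eq_value:
  assumes \<phi>: "mild_solution \<phi>" and t: "t \<in> {0..T}"
    and laws: "\<And>u s i. u \<in> markov_controls U \<Longrightarrow> 0 \<le> s
      \<Longrightarrow> solves_martingale_problem lam u s i (P u s i)"
  shows "\<phi> t i = value_V U P \<theta> c g T t i"
proof -
  obtain K where K: "regular \<phi> K" using \<phi> by (auto simp: mild_solution_def)
  obtain u where u: "u \<in> markov_controls U" "minimizing_selector U lam \<theta> c T \<phi> u"
    using minimizing_selector_exists[OF K] by blast
  have "(INF u\<in>markov_controls U. cost_J P \<theta> c g T u t i) = \<phi> t i"
  proof (rule cInf_eq_minimum)
    show "\<phi> t i \<in> (\<lambda>u. cost_J P \<theta> c g T u t i) ` markov_controls U"
      using verification(2)[where P=P, OF \<phi> u(1) t laws u(2)] u(1) t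
        by (intro image_eqI[of _ _ u]) auto
  next
    fix x assume "x \<in> (\<lambda>u. cost_J P \<theta> c g T u t i) ` markov_controls U"
    then show "\<phi> t i \<le> x" using verification(1)[where P=P, OF \<phi> _ t laws] t by auto
  qed
  then show ?thesis by (simp add: value_V_def)
qed

end

theorem theorem2p3:
  fixes U :: "nat \<Rightarrow> 'u::metric_space set"
    and lam :: "nat \<Rightarrow> nat \<Rightarrow> 'u \<Rightarrow> real"
    and M T \<theta> :: real
    and c :: "real \<Rightarrow> nat \<Rightarrow> 'u \<Rightarrow> real"
    and g :: "nat \<Rightarrow> real"
    and P :: "(real \<Rightarrow> nat \<Rightarrow> 'u) \<Rightarrow> real \<Rightarrow> nat \<Rightarrow> (real \<Rightarrow> nat) measure"
  assumes U_compact: "\<And>i. compact (U i)"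
    and U_nonempty: "\<And>i. U i \<noteq> {}"
    and rates_nonneg: "\<And>i j v. j \<noteq> i \<Longrightarrow> v \<in> U i \<Longrightarrow> 0 \<le> lam i j v"
    and rates_diag: "\<And>i v. v \<in> U i \<Longrightarrow> lam i i v = - (\<Sum>j. if j = i then 0 else lam i j v)"
    and A1: "\<And>i j. j \<noteq> i \<Longrightarrow> continuous_on (U i) (lam i j)"
    and A2: "\<And>i v. v \<in> U i \<Longrightarrow> - lam i i v \<le> M"
    and A3: "\<And>i. uniformly_convergent_on (U i) (\<lambda>n v. \<Sum>j<n. if j = i then 0 else lam i j v)"
    and laws: "\<And>u s i. u \<in> markov_controls U \<Longrightarrow> 0 \<le> s \<Longrightarrow>
                 solves_martingale_problem lam u s i (P u s i)"
    and T: "0 < T"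
    and theta: "\<theta> \<in> {0<..<1}"
    and c_nonneg: "\<And>t i v. 0 \<le> t \<Longrightarrow> v \<in> U i \<Longrightarrow> 0 \<le> c t i v"
    and c_bounded: "\<exists>B. \<forall>t\<ge>0. \<forall>i. \<forall>v\<in>U i. c t i v \<le> B"
    and c_continuous: "\<And>i. continuous_on ({0..} \<times> U i) (\<lambda>(t, v). c t i v)"
    and g_nonneg: "\<And>i. 0 \<le> g i"
    and g_bounded: "bounded (range g)"
  shows "HJB_solution U lam \<theta> c g T (value_V U P \<theta> c g T) \<and>
    (\<forall>\<phi>. HJB_solution U lam \<theta> c g T \<phi> \<longrightarrow>
       (\<forall>t\<in>{0..T}. \<forall>i. \<phi> t i = value_V U P \<theta> c g T t i)) \<and>
    (\<exists>u\<in>markov_controls U. minimizing_selector U lam \<theta> c T (value_V U P \<theta> c g T) u) \<and>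
    (\<forall>u\<in>markov_controls U. minimizing_selector U lam \<theta> c T (value_V U P \<theta> c g T) u \<longrightarrow>
       optimal_control U P \<theta> c g T u)"
proof -
  obtain B where B: "\<And>t i v. 0 \<le> t \<Longrightarrow> v \<in> U i \<Longrightarrow> c t i v \<le> B" using c_bounded by blast
  interpret control_problem U lam M \<theta> T B c g
    by unfold_locales (use assms B in auto)
  let ?V = "value_V U P \<theta> c g T"
  obtain \<phi> where \<phi>: "mild_solution \<phi>" using mild_solution_exists by blast
  \<comment> \<open>The regularity of the value function is not shown directly: it is inherited from
    the fixed point, with which it agrees on \<open>{0..T}\<close>. Verification can then be applied
    to the value function itself, and so to any of its minimizing selectors.\<close>
  have V: "mild_solution ?V"
    using mild_solution_cong[OF mild_solution_eq_value[OF \<phi> _ laws] \<phi>] by blast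
  then obtain K where K: "regular ?V K" by (auto simp: mild_solution_def)
  have "optimal_control U P \<theta> c g T u"
    if "u \<in> markov_controls U" "minimizing_selector U lam \<theta> c T ?V u" for u
    unfolding optimal_control_def using verification(2)[where P=P, OF V that(1) _ laws[OF that(1)] that(2)] that(1) by auto
  moreover have "\<phi> t i = ?V t i" if "HJB_solution U lam \<theta> c g T \<phi>" "t \<in> {0..T}" for \<phi> t i
    using mild_solution_eq_value[OF _ that(2) laws] that(1) HJB_solution_iff_mild by blast
  ultimately show ?thesis
    using V HJB_solution_iff_mild minimizing_selector_exists[OF K] by blast
qed

end
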